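(* Let $\mathfrak g=\mathfrak{sl}_n(\mathbb C)$, let $\alpha,\beta\in\Pi$ be adjacent simple roots (i.e. $\{\alpha,\beta\}=\{\alpha_i,\alpha_{i+1}\}$ for some $i$), and let $w,y\in D_{\alpha,\beta}\subset \mathbf S_n$. Then $$\mathcal V_w\subset\overline{\mathcal V}_y\quad\text{if and only if}\quad \mathcal V_{\mathcal T_{\alpha,\beta}(w)}\subset\overline{\mathcal V}_{\mathcal T_{\alpha,\beta}(y)} .$$
   Context: Let $\mathbf G=SL_n(\mathbb C)$, $\mathbf B$ its subgroup of upper triangular matrices, $\mathfrak n$ the strictly upper triangular matrices; $\mathbf G$ and $\mathbf B$ act by conjugation. The Weyl group is $W=\mathbf S_n$; $\Pi=\{\alpha_1,\dots,\alpha_{n-1}\}$ are the simple roots ($\alpha_i=\varepsilon_i-\varepsilon_{i+1}$), and $s_i=s_{\alpha_i}$ is the transposition $(i,i+1)$. For $w\in\mathbf S_n$ put $\mathfrak n\cap{}^w\mathfrak n=\operatorname{span}\{e_{ij}: i<j,\ w^{-1}(i)<w^{-1}(j)\}$. The Zariski closure $\overline{\mathbf G(\mathfrak n\cap{}^w\mathfrak n)}$ is the closure of a unique nilpotent orbit $\mathcal O_w$, and $\mathcal V_w:=\overline{\mathbf B(\mathfrak n\cap{}^w\mathfrak n)}\cap\mathcal O_w$ is an orbital variety (an irreducible component of $\mathcal O_w\cap\mathfrak n$); every orbital variety is of this form. Bars denote Zariski closure. The $\tau$-invariant is $\tau(w)=\{\alpha_i\in\Pi: w^{-1}(i)>w^{-1}(i+1)\}$.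 For adjacent simple roots $\alpha,\beta$ put $D_{\alpha,\beta}=\{w\in W:\alpha\notin\tau(w),\ \beta\in\tau(w)\}$. For $w\in D_{\alpha,\beta}$ define $\mathcal T_{\alpha,\beta}(w)=s_\alpha w$ if $\beta\notin\tau(s_\alpha w)$, and $\mathcal T_{\alpha,\beta}(w)=s_\beta w$ otherwise; then $\mathcal T_{\alpha,\beta}(w)\in D_{\beta,\alpha}$. *)

theory Defs
  imports "Jordan_Normal_Form.Determinant" "HOL-Combinatorics.Combinatorics"
begin

text \<open>
  Matrix indices run over \<open>0, \<dots>, n - 1\<close>, as in the matrix library.
  Accordingly \<open>\<S>\<^sub>n\<close> acts on \<open>{..<n}\<close>, and the simple root
  \<open>\<epsilon>\<^sub>i - \<epsilon>\<^sub>i\<^sub>+\<^sub>1\<close> is represented by its (0-based) index \<open>i\<close>, so that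
  \<open>i\<close> stands for the root usually called \<open>\<alpha>\<^sub>i\<^sub>+\<^sub>1\<close>.
\<close>

subsection \<open>Groups and Lie algebras\<close>

definition SL :: "nat \<Rightarrow> complex mat set" where
  "SL n = {g \<in> carrier_mat n n. det g = 1}"

definition Borel :: "nat \<Rightarrow> complex mat set" where
  "Borel n = {g \<in> SL n. upper_triangular g}"

definition sl :: "nat \<Rightarrow> complex mat set" where
  "sl n = {A \<in> carrier_mat n n. (\<Sum>i<n. A $$ (i, i)) = 0}"

text \<open>\<open>saturation H S\<close> is \<open>H(S) = {g X g\<^sup>-\<^sup>1 | g \<in> H, X \<in> S}\<close>; the matrix \<open>h\<close> is forced
  to be the inverse of \<open>g\<close>.\<close>

definition saturation :: "complex mat set \<Rightarrow> complex mat set \<Rightarrow> complex mat set" where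
  "saturation H S = {A. \<exists>X\<in>S. \<exists>g\<in>H. \<exists>h. similar_mat_wit A X g h}"

definition nilpotent_orbits :: "nat \<Rightarrow> complex mat set set" where
  "nilpotent_orbits n =
     {saturation (SL n) {X} | X. X \<in> sl n \<and> (\<exists>k. X ^\<^sub>m k = 0\<^sub>m n n)}"

subsection \<open>Zariski closure\<close>

inductive_set polynomial_functions :: "nat \<Rightarrow> (complex mat \<Rightarrow> complex) set" for n where
  const: "(\<lambda>_. c) \<in> polynomial_functions n"
| entry: "i < n \<Longrightarrow> j < n \<Longrightarrow> (\<lambda>A. A $$ (i, j)) \<in> polynomial_functions n"
| add: "f \<in> polynomial_functions n \<Longrightarrow> g \<in> polynomial_functions n \<Longrightarrow>
    (\<lambda>A. f A + g A) \<in> polynomial_functions n"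
| mult: "f \<in> polynomial_functions n \<Longrightarrow> g \<in> polynomial_functions n \<Longrightarrow>
    (\<lambda>A. f A * g A) \<in> polynomial_functions n"

text \<open>Closure in the affine space \<open>\<ss>\<ll>\<^sub>n\<close>, meant for subsets of it. The polynomial functions on
  this linear subspace are the restrictions of those on all matrices.\<close>

definition zariski_closure :: "nat \<Rightarrow> complex mat set \<Rightarrow> complex mat set" where
  "zariski_closure n S =
     {A \<in> sl n. \<forall>f\<in>polynomial_functions n. (\<forall>X\<in>S. f X = 0) \<longrightarrow> f A = 0}"

subsection \<open>Orbital varieties\<close>

text \<open>The span of the matrix units \<open>e\<^sub>i\<^sub>j\<close> with \<open>i < j\<close> and \<open>w\<^sup>-\<^sup>1(i) < w\<^sup>-\<^sup>1(j)\<close>.\<close>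

definition n_cap_conj :: "nat \<Rightarrow> (nat \<Rightarrow> nat) \<Rightarrow> complex mat set" where
  "n_cap_conj n w =
     {mat n n (\<lambda>(i, j). if i < j \<and> Hilbert_Choice.inv w i < Hilbert_Choice.inv w j then c i j else 0) | c. True}"

definition orbit_of_perm :: "nat \<Rightarrow> (nat \<Rightarrow> nat) \<Rightarrow> complex mat set" where
  "orbit_of_perm n w =
     (THE Orb. Orb \<in> nilpotent_orbits n \<and>
       zariski_closure n Orb = zariski_closure n (saturation (SL n) (n_cap_conj n w)))"

definition orbital_variety :: "nat \<Rightarrow> (nat \<Rightarrow> nat) \<Rightarrow> complex mat set" where
  "orbital_variety n w =
     zariski_closure n (saturation (Borel n) (n_cap_conj n w)) \<inter> orbit_of_perm n w"

subsection \<open>\<open>\<tau>\<close>-invariant and the operators \<open>\<T>\<^sub>\<alpha>\<^sub>\<beta>\<close>\<close>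

definition simple_roots :: "nat \<Rightarrow> nat set" where
  "simple_roots n = {i. i + 1 < n}"

definition adjacent_roots :: "nat \<Rightarrow> nat \<Rightarrow> bool" where
  "adjacent_roots \<alpha> \<beta> \<longleftrightarrow> (\<exists>i. {\<alpha>, \<beta>} = {i, i + 1})"

definition simple_reflection :: "nat \<Rightarrow> nat \<Rightarrow> nat" where
  "simple_reflection \<alpha> = Transposition.transpose \<alpha> (\<alpha> + 1)"

definition tau :: "nat \<Rightarrow> (nat \<Rightarrow> nat) \<Rightarrow> nat set" where
  "tau n w = {i \<in> simple_roots n. Hilbert_Choice.inv w i > Hilbert_Choice.inv w (i + 1)}"

definition D_set :: "nat \<Rightarrow> nat \<Rightarrow> nat \<Rightarrow> (nat \<Rightarrow> nat) set" where
  "D_set n \<alpha> \<beta> = {w. w permutes {..<n} \<and> \<alpha> \<notin> tau n w \<and> \<beta> \<in> tau n w}"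

definition T_op :: "nat \<Rightarrow> nat \<Rightarrow> nat \<Rightarrow> (nat \<Rightarrow> nat) \<Rightarrow> (nat \<Rightarrow> nat)" where
  "T_op n \<alpha> \<beta> w =
     (if \<beta> \<notin> tau n (simple_reflection \<alpha> \<circ> w) then simple_reflection \<alpha> \<circ> w
      else simple_reflection \<beta> \<circ> w)"

end

theory Submission
  imports Defs "Jordan_Normal_Form.Jordan_Normal_Form_Existence"
    "Jordan_Normal_Form.Jordan_Normal_Form_Uniqueness"
begin

text \<open>
  Write \<open>C\<^sub>w\<close> for the closure of \<open>B(\<nn> \<inter> \<^sup>w\<nn>)\<close>. Nilpotent orbits are separated by the kernel
  dimensions of powers, which are semicontinuous, so the generic elements of \<open>\<nn> \<inter> \<^sup>w\<nn>\<close> lie in a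
  single orbit and \<open>C\<^sub>w\<close> is the closure of the orbital variety. The statement becomes
  \<open>C\<^sub>w \<subseteq> C\<^sub>y\<close> iff \<open>C\<^sub>T\<^sub>w \<subseteq> C\<^sub>T\<^sub>y\<close>, and one implication suffices as \<open>T\<^sub>\<beta>\<^sub>\<alpha>\<close> inverts \<open>T\<^sub>\<alpha>\<^sub>\<beta>\<close>.

  Let \<open>Z\<close> be the set of strictly upper triangular matrices whose coordinates at \<open>\<alpha>\<close> and \<open>\<beta>\<close> vanish
  while the one at \<open>\<alpha> + \<beta>\<close> does not. If \<open>k\<close> lies in the \<open>\<tau>\<close>-invariant of \<open>w\<close>, then \<open>C\<^sub>w\<close> is stable under
  the minimal parabolic subgroup \<open>P\<^sub>k\<close>. Hence, for \<open>y\<close> in \<open>D\<^sub>\<alpha>\<^sub>\<beta>\<close>, retracting along \<open>P\<^sub>\<beta>\<close> gives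
  \<open>C\<^sub>y \<inter> Z \<subseteq> C\<^sub>T\<^sub>y\<close>, and a generic element of \<open>\<nn> \<inter> \<^sup>T\<^sup>w\<nn>\<close> is conjugate under \<open>P\<^sub>\<alpha>\<close> to an element of
  \<open>C\<^sub>w \<inter> Z\<close>. As \<open>C\<^sub>T\<^sub>y\<close> is \<open>P\<^sub>\<alpha>\<close>-stable, \<open>C\<^sub>w \<subseteq> C\<^sub>y\<close> implies \<open>C\<^sub>T\<^sub>w \<subseteq> C\<^sub>T\<^sub>y\<close>.
\<close>

section \<open>Polynomial functions\<close>

text \<open>Three algebras are treated alike: the polynomial functions on matrices, the univariate
  polynomials, and the functions that become polynomial after multiplication by a power of
  \<open>sum_entry\<close>. They serve for regular maps, for curves and for a rational
  retraction.\<close>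

locale function_algebra =
  fixes F :: "('a \<Rightarrow> complex) set"
  assumes const_mem: "(\<lambda>_. c) \<in> F"
    and add_mem: "f \<in> F \<Longrightarrow> g \<in> F \<Longrightarrow> (\<lambda>x. f x + g x) \<in> F"
    and mult_mem: "f \<in> F \<Longrightarrow> g \<in> F \<Longrightarrow> (\<lambda>x. f x * g x) \<in> F"
begin

lemma sum_mem: "(\<And>i. i \<in> I \<Longrightarrow> f i \<in> F) \<Longrightarrow> (\<lambda>x. \<Sum>i\<in>I. f i x) \<in> F"
  by (induction I rule: infinite_finite_induct) (auto intro: const_mem add_mem)

lemma prod_mem: "(\<And>i. i \<in> I \<Longrightarrow> f i \<in> F) \<Longrightarrow> (\<lambda>x. \<Prod>i\<in>I. f i x) \<in> F"
  by (induction I rule: infinite_finite_induct) (auto intro: const_mem mult_mem)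

lemma power_mem: "f \<in> F \<Longrightarrow> (\<lambda>x. f x ^ k) \<in> F"
  by (induction k) (auto intro: const_mem mult_mem)

lemma uminus_mem: "f \<in> F \<Longrightarrow> (\<lambda>x. - f x) \<in> F"
  using mult_mem[OF const_mem[of "-1"], of f] by simp

lemma diff_mem: "f \<in> F \<Longrightarrow> g \<in> F \<Longrightarrow> (\<lambda>x. f x - g x) \<in> F"
  using add_mem[OF _ uminus_mem, of f g] by simp

definition matrices :: "nat \<Rightarrow> nat \<Rightarrow> ('a \<Rightarrow> complex mat) set" where
  "matrices r c = {M. (\<forall>x. M x \<in> carrier_mat r c) \<and> (\<forall>i<r. \<forall>j<c. (\<lambda>x. M x $$ (i, j)) \<in> F)}"

lemma matricesI:
  assumes "\<And>x. M x \<in> carrier_mat r c" "\<And>i j. i < r \<Longrightarrow> j < c \<Longrightarrow> (\<lambda>x. M x $$ (i, j)) \<in> F"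
  shows "M \<in> matrices r c"
  using assms by (auto simp: matrices_def)

lemma matrices_carrier: "M \<in> matrices r c \<Longrightarrow> M x \<in> carrier_mat r c"
  by (auto simp: matrices_def)

lemma matrices_entry: "M \<in> matrices r c \<Longrightarrow> i < r \<Longrightarrow> j < c \<Longrightarrow> (\<lambda>x. M x $$ (i, j)) \<in> F"
  by (auto simp: matrices_def)

lemma matrices_const: "A \<in> carrier_mat r c \<Longrightarrow> (\<lambda>_. A) \<in> matrices r c"
  by (auto intro: matricesI const_mem)

lemma matrices_add:
  assumes "M \<in> matrices r c" "N \<in> matrices r c"
  shows "(\<lambda>x. M x + N x) \<in> matrices r c"
proof (rule matricesI)
  fix i j assume "i < r" "j < c"
  then have "(M x + N x) $$ (i, j) = M x $$ (i, j) + N x $$ (i, j)" for x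
    using matrices_carrier[OF assms(2), of x] by auto
  with \<open>i < r\<close> \<open>j < c\<close> show "(\<lambda>x. (M x + N x) $$ (i, j)) \<in> F"
    using add_mem[OF matrices_entry[OF assms(1)] matrices_entry[OF assms(2)], of i j i j] by simp
qed (use matrices_carrier assms in auto)

lemma matrices_mult:
  assumes "M \<in> matrices r m" "N \<in> matrices m c"
  shows "(\<lambda>x. M x * N x) \<in> matrices r c"
proof (rule matricesI)
  fix i j assume ij: "i < r" "j < c"
  have "(M x * N x) $$ (i, j) = (\<Sum>k\<in>{0..<m}. M x $$ (i, k) * N x $$ (k, j))" for x
    using ij matrices_carrier[OF assms(1), of x] matrices_carrier[OF assms(2), of x]
    by (auto simp: scalar_prod_def carrier_matD intro!: sum.cong)
  then show "(\<lambda>x. (M x * N x) $$ (i, j)) \<in> F"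
    using ij by (auto intro!: sum_mem mult_mem matrices_entry[OF assms(1)] matrices_entry[OF assms(2)])
qed (use matrices_carrier assms in \<open>auto intro!: mult_carrier_mat\<close>)

lemma matrices_pow:
  assumes "M \<in> matrices n n"
  shows "(\<lambda>x. M x ^\<^sub>m k) \<in> matrices n n"
proof (induction k)
  case 0
  have "M x ^\<^sub>m 0 = 1\<^sub>m n" for x
    using matrices_carrier[OF assms, of x] by simp
  then show ?case by (simp add: matrices_const)
next
  case (Suc k)
  show ?case using matrices_mult[OF Suc assms] by simp
qed

lemma det_mem:
  assumes "M \<in> matrices r r"
  shows "(\<lambda>x. det (M x)) \<in> F"
proof -
  have "det (M x) = (\<Sum>p\<in>{p. p permutes {0..<r}}. signof p * (\<Prod>i\<in>{0..<r}. M x $$ (i, p i)))" for x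
    using matrices_carrier[OF assms, of x] by (rule det_def')
  moreover have "(\<lambda>x. signof p * (\<Prod>i\<in>{0..<r}. M x $$ (i, p i))) \<in> F"
    if "p permutes {0..<r}" for p
    using permutes_in_image[OF that]
    by (intro mult_mem const_mem prod_mem matrices_entry[OF assms]) auto
  ultimately show ?thesis
    by (auto intro!: sum_mem)
qed

text \<open>By induction on the generation of polynomial functions. This is how an equation of a
  closed set is pulled back along a regular map, a curve or a rational map.\<close>

lemma polynomial_function_comp:
  assumes "f \<in> polynomial_functions n" "M \<in> matrices n n"
  shows "(\<lambda>x. f (M x)) \<in> F"
  using assms(1)
  by induction (auto intro: const_mem add_mem mult_mem matrices_entry[OF assms(2)])

end

interpretation polynomial_functions: function_algebra "polynomial_functions n" for n
  by unfold_locales (auto intro: polynomial_functions.intros)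

text \<open>Polynomial functions are total on the type of all matrices, while the matrix operations need
  their arguments to have the right size; \<open>trunc\<close> reconciles the two.\<close>

definition trunc :: "nat \<Rightarrow> 'a mat \<Rightarrow> 'a mat" where
  "trunc n A = mat n n (\<lambda>(i, j). A $$ (i, j))"

lemma trunc_id [simp]: "A \<in> carrier_mat n n \<Longrightarrow> trunc n A = A"
  by (auto simp: trunc_def)

lemma trunc_mem: "trunc n \<in> polynomial_functions.matrices n n n"
  by (rule polynomial_functions.matricesI) (auto simp: trunc_def intro: polynomial_functions.entry)

section \<open>Polynomial functions of one parameter\<close>

definition univariate :: "(complex \<Rightarrow> complex) set" where
  "univariate = {f. \<exists>p. \<forall>t. f t = poly p t}"

interpretation univariate: function_algebra univariate
proof
  show "(\<lambda>_. c) \<in> univariate" for c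
    unfolding univariate_def by (auto intro: exI[of _ "[:c:]"])
  show "(\<lambda>x. f x + g x) \<in> univariate" if fg: "f \<in> univariate" "g \<in> univariate" for f g
  proof -
    from fg obtain p q where "\<forall>t. f t = poly p t" "\<forall>t. g t = poly q t"
      unfolding univariate_def by blast
    then show ?thesis unfolding univariate_def by (auto intro!: exI[of _ "p + q"])
  qed
  show "(\<lambda>x. f x * g x) \<in> univariate" if fg: "f \<in> univariate" "g \<in> univariate" for f g
  proof -
    from fg obtain p q where "\<forall>t. f t = poly p t" "\<forall>t. g t = poly q t"
      unfolding univariate_def by blast
    then show ?thesis unfolding univariate_def by (auto intro!: exI[of _ "p * q"])
  qed
qed

lemma univariate_id: "(\<lambda>t. t) \<in> univariate"
  unfolding univariate_def by (auto intro: exI[of _ "[:0, 1:]"])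

lemma univariate_zeros:
  assumes "f \<in> univariate"
  shows "finite {t. f t = 0} \<or> (\<forall>t. f t = 0)"
proof -
  from assms obtain p where "\<forall>t. f t = poly p t" unfolding univariate_def by blast
  then show ?thesis using poly_roots_finite[of p] by (cases "p = 0") auto
qed

text \<open>The roots of a nonzero polynomial together with \<open>T\<close> form a finite set,
  which cannot be the whole infinite field.\<close>

lemma univariate_identically_zero:
  assumes "f \<in> univariate" "finite T" "\<And>t. t \<notin> T \<Longrightarrow> f t = 0"
  shows "f t = 0"
proof (rule ccontr)
  assume "f t \<noteq> 0"
  then have "finite {t. f t = 0}"
    using univariate_zeros[OF assms(1)] by blast
  then have "finite (T \<union> {t. f t = 0})" using assms(2) by simp
  moreover have "T \<union> {t. f t = 0} = UNIV" using assms(3) by auto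
  ultimately show False
    using infinite_UNIV_char_0 by (metis (full_types))
qed

section \<open>Zariski closure\<close>

lemma sl_carrier: "A \<in> sl n \<Longrightarrow> A \<in> carrier_mat n n"
  by (simp add: sl_def)

lemma zariski_closure_sl: "zariski_closure n S \<subseteq> sl n"
  by (auto simp: zariski_closure_def)

lemma zariski_closureD:
  "A \<in> zariski_closure n S \<Longrightarrow> f \<in> polynomial_functions n \<Longrightarrow> (\<And>X. X \<in> S \<Longrightarrow> f X = 0) \<Longrightarrow> f A = 0"
  by (auto simp: zariski_closure_def)

lemma zariski_closureI:
  "A \<in> sl n \<Longrightarrow> (\<And>f. f \<in> polynomial_functions n \<Longrightarrow> (\<And>X. X \<in> S \<Longrightarrow> f X = 0) \<Longrightarrow> f A = 0)
    \<Longrightarrow> A \<in> zariski_closure n S"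
  by (auto simp: zariski_closure_def)

lemma zariski_closure_incl: "S \<subseteq> sl n \<Longrightarrow> S \<subseteq> zariski_closure n S"
  by (auto simp: zariski_closure_def)

lemma zariski_closure_minimal:
  assumes "S \<subseteq> zariski_closure n T"
  shows "zariski_closure n S \<subseteq> zariski_closure n T"
proof
  fix A assume A: "A \<in> zariski_closure n S"
  show "A \<in> zariski_closure n T"
  proof (rule zariski_closureI)
    show "A \<in> sl n" using A zariski_closure_sl by blast
    fix f assume f: "f \<in> polynomial_functions n" "\<And>X. X \<in> T \<Longrightarrow> f X = 0"
    show "f A = 0"
      by (rule zariski_closureD[OF A f(1)]) (use assms f in \<open>blast intro: zariski_closureD\<close>)
  qed
qed

text \<open>Continuity of regular maps: an equation for \<open>T\<close> pulls back along
  \<open>\<phi>\<close> to an equation for \<open>S\<close>.\<close>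

lemma zariski_closure_image:
  assumes A: "A \<in> zariski_closure n S" and \<phi>: "\<phi> \<in> polynomial_functions.matrices n n n"
    and "\<phi> A \<in> sl n" and S: "\<And>X. X \<in> S \<Longrightarrow> \<phi> X \<in> zariski_closure n T"
  shows "\<phi> A \<in> zariski_closure n T"
proof (rule zariski_closureI)
  fix f assume f: "f \<in> polynomial_functions n" and fT: "\<And>X. X \<in> T \<Longrightarrow> f X = 0"
  from A show "f (\<phi> A) = 0"
    by (rule zariski_closureD[OF _ polynomial_functions.polynomial_function_comp[OF f \<phi>]])
      (use zariski_closureD[OF S f fT] in auto)
qed fact

text \<open>An equation for \<open>S\<close> restricted to the curve is a polynomial in the
  parameter that vanishes outside \<open>T\<close>, hence everywhere. Special points are thus
  reached from generic parameters.\<close>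

lemma zariski_closure_curve:
  assumes M: "M \<in> univariate.matrices n n" and "M t \<in> sl n" and "finite T"
    and T: "\<And>t. t \<notin> T \<Longrightarrow> M t \<in> zariski_closure n S"
  shows "M t \<in> zariski_closure n S"
proof (rule zariski_closureI)
  fix f assume f: "f \<in> polynomial_functions n" and fS: "\<And>X. X \<in> S \<Longrightarrow> f X = 0"
  show "f (M t) = 0"
    by (rule univariate_identically_zero[OF univariate.polynomial_function_comp[OF f M] \<open>finite T\<close>])
      (use zariski_closureD[OF T f fS] in auto)
qed fact

definition line :: "complex mat \<Rightarrow> complex mat \<Rightarrow> complex \<Rightarrow> complex mat" where
  "line A B t = A + t \<cdot>\<^sub>m (B - A)"

lemma line_mem:
  assumes "A \<in> carrier_mat n n" "B \<in> carrier_mat n n"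
  shows "line A B \<in> univariate.matrices n n"
  using assms unfolding line_def
  by (intro univariate.matricesI)
    (auto intro!: univariate.add_mem univariate.mult_mem univariate.const_mem univariate_id)

lemma line_0: "A \<in> carrier_mat n n \<Longrightarrow> B \<in> carrier_mat n n \<Longrightarrow> line A B 0 = A"
  and line_1: "A \<in> carrier_mat n n \<Longrightarrow> B \<in> carrier_mat n n \<Longrightarrow> line A B 1 = B"
  by (auto simp: line_def)

text \<open>A nonempty Zariski open subset of an affine subspace is dense: restrict to the line joining
  an arbitrary point to a point of the open set.\<close>

lemma affine_subset_zariski_closure:
  assumes L: "L \<subseteq> sl n" "\<And>A B t. A \<in> L \<Longrightarrow> B \<in> L \<Longrightarrow> line A B t \<in> L"
    and h: "h \<in> polynomial_functions n" "B \<in> L" "h B \<noteq> 0"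
    and S: "\<And>X. X \<in> L \<Longrightarrow> h X \<noteq> 0 \<Longrightarrow> X \<in> zariski_closure n S"
  shows "L \<subseteq> zariski_closure n S"
proof
  fix A assume A: "A \<in> L"
  have C: "A \<in> carrier_mat n n" "B \<in> carrier_mat n n"
    using A h(2) L(1) sl_carrier by auto
  have "(\<lambda>t. h (line A B t)) \<in> univariate"
    by (rule univariate.polynomial_function_comp[OF h(1) line_mem[OF C]])
  moreover have "h (line A B 1) \<noteq> 0" using h(3) line_1[OF C] by simp
  ultimately have fin: "finite {t. h (line A B t) = 0}"
    using univariate_zeros by blast
  have "line A B 0 \<in> zariski_closure n S"
    by (rule zariski_closure_curve[OF line_mem[OF C] _ fin]) (use L A h(2) S in auto)
  then show "A \<in> zariski_closure n S" using line_0[OF C] by simp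
qed

section \<open>Conjugation\<close>

lemma trace_mult_commute:
  assumes "A \<in> carrier_mat n n" "B \<in> carrier_mat n n"
  shows "(\<Sum>i<n. (A * B) $$ (i, i)) = (\<Sum>i<n. ((B :: 'a :: comm_semiring_0 mat) * A) $$ (i, i))"
proof -
  have "(\<Sum>i<n. (A * B) $$ (i, i)) = (\<Sum>i<n. \<Sum>j<n. A $$ (i, j) * B $$ (j, i))"
    using assms by (auto simp: scalar_prod_def atLeast0LessThan intro!: sum.cong)
  also have "\<dots> = (\<Sum>j<n. \<Sum>i<n. B $$ (j, i) * A $$ (i, j))"
    by (subst sum.swap) (simp add: mult.commute)
  also have "\<dots> = (\<Sum>i<n. (B * A) $$ (i, i))"
    using assms by (auto simp: scalar_prod_def atLeast0LessThan intro!: sum.cong)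
  finally show ?thesis .
qed

lemma similar_mat_wit_sl:
  assumes "similar_mat_wit A X g h" "X \<in> sl n"
  shows "A \<in> sl n"
proof -
  from assms(1) obtain m where *: "A \<in> carrier_mat m m" "X \<in> carrier_mat m m" "g \<in> carrier_mat m m"
    "h \<in> carrier_mat m m" "h * g = 1\<^sub>m m" "A = g * X * h"
    by (auto simp: similar_mat_wit_def Let_def)
  then have m: "m = n" using sl_carrier[OF assms(2)] by auto
  have "(\<Sum>i<n. A $$ (i, i)) = (\<Sum>i<n. (h * (g * X)) $$ (i, i))"
    using trace_mult_commute[of "g * X" n h] * unfolding m by auto
  also have "h * (g * X) = X"
    using * unfolding m by (simp flip: assoc_mult_mat[of h n n g n X n])
  finally show ?thesis using * assms(2) unfolding m by (auto simp: sl_def)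
qed

lemma saturation_sl: "S \<subseteq> sl n \<Longrightarrow> saturation H S \<subseteq> sl n"
  by (auto simp: saturation_def dest: similar_mat_wit_sl)

lemma saturation_minimal: "S \<subseteq> T \<Longrightarrow> saturation H T \<subseteq> T \<Longrightarrow> saturation H S \<subseteq> T"
  unfolding saturation_def by blast

lemma saturationI: "X \<in> S \<Longrightarrow> g \<in> H \<Longrightarrow> similar_mat_wit A X g h \<Longrightarrow> A \<in> saturation H S"
  by (auto simp: saturation_def)

text \<open>Conjugation by one fixed \<open>g\<close> is a polynomial map, so it carries closures
  into closures. In particular, the closure of an \<open>H\<close>-stable subset of
  \<open>sl n\<close> is \<open>H\<close>-stable.\<close>

lemma saturation_zariski_closure:
  assumes "S \<subseteq> sl n" "saturation H S \<subseteq> zariski_closure n T"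
  shows "saturation H (zariski_closure n S) \<subseteq> zariski_closure n T"
proof
  fix A assume "A \<in> saturation H (zariski_closure n S)"
  then obtain X g h where X: "X \<in> zariski_closure n S" and g: "g \<in> H" and wit: "similar_mat_wit A X g h"
    by (auto simp: saturation_def)
  have Xsl: "X \<in> sl n" using X zariski_closure_sl by blast
  have Asl: "A \<in> sl n" using similar_mat_wit_sl[OF wit Xsl] .
  note w = similar_mat_witD2[OF sl_carrier[OF Asl] wit]
  define \<phi> where "\<phi> = (\<lambda>X. g * trunc n X * h)"
  have "\<phi> \<in> polynomial_functions.matrices n n n"
    unfolding \<phi>_def
    by (intro polynomial_functions.matrices_mult[OF polynomial_functions.matrices_mult[OF
          polynomial_functions.matrices_const trunc_mem] polynomial_functions.matrices_const] w)
  moreover have A: "\<phi> X = A" using w by (simp add: \<phi>_def)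
  moreover have "\<phi> Y \<in> zariski_closure n T" if Y: "Y \<in> S" for Y
  proof -
    have "Y \<in> carrier_mat n n" using Y assms(1) sl_carrier by blast
    then have "similar_mat_wit (\<phi> Y) Y g h"
      by (intro similar_mat_witI[where n = n]) (use w in \<open>auto simp: \<phi>_def\<close>)
    then show ?thesis using Y g assms(2) by (auto intro: saturationI)
  qed
  ultimately show "A \<in> zariski_closure n T"
    using zariski_closure_image[OF X, of \<phi> T] Asl by metis
qed

section \<open>Similarity of nilpotent matrices and semicontinuity\<close>

lemma similar_four_block_swap:
  assumes A: "A \<in> carrier_mat n n" and B: "(B :: 'a :: comm_ring_1 mat) \<in> carrier_mat m m"
  shows "similar_mat (four_block_mat A (0\<^sub>m n m) (0\<^sub>m m n) B) (four_block_mat B (0\<^sub>m m n) (0\<^sub>m n m) A)"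
proof -
  let ?P = "four_block_mat (0\<^sub>m n m) (1\<^sub>m n) (1\<^sub>m m) (0\<^sub>m m n) :: 'a mat"
  let ?Q = "four_block_mat (0\<^sub>m m n) (1\<^sub>m m) (1\<^sub>m n) (0\<^sub>m n m) :: 'a mat"
  let ?X = "four_block_mat A (0\<^sub>m n m) (0\<^sub>m m n) B"
  let ?Y = "four_block_mat B (0\<^sub>m m n) (0\<^sub>m n m) A"
  have P: "?P \<in> carrier_mat (n + m) (n + m)" and Q: "?Q \<in> carrier_mat (n + m) (n + m)"
    by (intro carrier_matI; simp add: add.commute)+
  have X: "?X \<in> carrier_mat (n + m) (n + m)" and Y: "?Y \<in> carrier_mat (n + m) (n + m)"
    using A B by (intro carrier_matI; simp add: add.commute)+
  have "?P * ?Q = four_block_mat (1\<^sub>m n) (0\<^sub>m n m) (0\<^sub>m m n) (1\<^sub>m m)"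
    by (subst mult_four_block_mat[of _ n m _ n _ m]) auto
  moreover have "?Q * ?P = four_block_mat (1\<^sub>m m) (0\<^sub>m m n) (0\<^sub>m n m) (1\<^sub>m n)"
    by (subst mult_four_block_mat[of _ m n _ m _ n]) auto
  moreover have "?P * ?Y = four_block_mat (0\<^sub>m n m) A B (0\<^sub>m m n)"
    using A B by (subst mult_four_block_mat[of _ n m _ n _ m]) auto
  moreover have "four_block_mat (0\<^sub>m n m) A B (0\<^sub>m m n) * ?Q = ?X"
    using A B by (subst mult_four_block_mat[of _ n m _ n _ m]) auto
  ultimately have "?P * ?Q = 1\<^sub>m (n + m)" "?Q * ?P = 1\<^sub>m (n + m)" "?X = ?P * ?Y * ?Q"
    by (simp_all add: add.commute)
  then show ?thesis
    unfolding similar_mat_def using similar_mat_witI[OF _ _ _ X Y P Q] by blast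
qed

lemma jordan_matrix_append:
  "jordan_matrix (xs @ ys) = four_block_mat (jordan_matrix xs)
     (0\<^sub>m (sum_list (map fst xs)) (sum_list (map fst ys)))
     (0\<^sub>m (sum_list (map fst ys)) (sum_list (map fst xs))) (jordan_matrix ys)"
proof -
  have *: "jordan_matrix zs = diag_block_mat (map (\<lambda>(n, a). jordan_block n a) zs)" for zs :: "(nat \<times> 'a) list"
    by (simp add: jordan_matrix_def)
  show ?thesis
    using diag_block_mat_append[of "map (\<lambda>(n, a). jordan_block n a) xs" "map (\<lambda>(n, a). jordan_block n a) ys"]
    by (simp add: Let_def flip: *) (simp add: *[of "xs @ ys"])
qed

lemma similar_jordan_matrix_append:
  "similar_mat (jordan_matrix (xs @ ys)) (jordan_matrix (ys @ xs) :: 'a :: comm_ring_1 mat)"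
  unfolding jordan_matrix_append
  by (rule similar_four_block_swap) simp_all

text \<open>Exchanging the two halves of a list moves an occurrence of the head of \<open>xs\<close>
  to the front of \<open>ys\<close>; the tails are then compared by induction.\<close>

lemma similar_jordan_matrix_mset:
  assumes "mset xs = mset ys"
  shows "similar_mat (jordan_matrix xs) (jordan_matrix ys :: 'a :: comm_ring_1 mat)"
  using assms
proof (induction xs arbitrary: ys)
  case Nil
  then show ?case by (auto intro: similar_mat_refl[OF jordan_matrix_carrier])
next
  case (Cons a xs)
  then have "a \<in> set ys" by (metis list.set_intros(1) set_mset_mset)
  then obtain l r where ys: "ys = l @ a # r" by (auto simp: in_set_conv_decomp)
  have "mset xs = mset (r @ l)" using Cons.prems ys by simp
  from Cons.IH[OF this] have IH: "similar_mat (jordan_matrix xs) (jordan_matrix (r @ l) :: 'a mat)" .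
  have "sum_list (map fst xs) = sum_list (map fst (r @ l))"
    using arg_cong[OF \<open>mset xs = mset (r @ l)\<close>, of "\<lambda>M. sum_mset (image_mset fst M)"]
    by (metis mset_map sum_mset_sum_list)
  then have "similar_mat (jordan_matrix ([a] @ xs)) (jordan_matrix ([a] @ (r @ l)) :: 'a mat)"
    unfolding jordan_matrix_append[of "[a]"]
    using similar_mat_four_block_0_0[OF similar_mat_refl IH, of "jordan_matrix [a]" "fst a" "fst a" "sum_list (map fst xs)"]
      jordan_matrix_carrier[of "[a]"] jordan_matrix_carrier[of xs] by simp
  moreover have "similar_mat (jordan_matrix ((a # r) @ l)) (jordan_matrix ys :: 'a mat)"
    unfolding ys by (rule similar_jordan_matrix_append)
  ultimately show ?case using similar_mat_trans by fastforce
qed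

text \<open>The kernel dimensions of the powers of \<open>A - ev\<close> determine the number of
  Jordan blocks of every size and eigenvalue, so Jordan forms of \<open>A\<close> and
  \<open>B\<close> differ only in the order of their blocks.\<close>

lemma similar_iff_dim_gen_eigenspace:
  assumes A: "(A :: complex mat) \<in> carrier_mat n n" and B: "B \<in> carrier_mat n n"
  shows "similar_mat A B \<longleftrightarrow> dim_gen_eigenspace A = dim_gen_eigenspace B"
proof
  assume eq: "dim_gen_eigenspace A = dim_gen_eigenspace B"
  obtain xs ys where xs: "jordan_nf A xs" and ys: "jordan_nf B ys"
    using jordan_nf_exists char_poly_factorized A B by metis
  have "count (mset xs) ka = count (mset ys) ka" for ka
  proof (cases "fst ka = 0")
    \<comment> \<open>Blocks of size 0 are excluded by \<open>jordan_nf\<close>, while the counting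
      formula asks for a nonzero size.\<close>
    case True
    then have "ka \<notin> set xs" "ka \<notin> set ys"
      using xs ys by (force simp: jordan_nf_def)+
    then have "ka \<notin># mset xs" "ka \<notin># mset ys" by simp_all
    then show ?thesis by (simp only: not_in_iff)
  next
    case False
    have "compute_nr_of_jordan_blocks A = compute_nr_of_jordan_blocks B"
      unfolding compute_nr_of_jordan_blocks_def[abs_def] eq by simp
    then show ?thesis
      using compute_nr_of_jordan_blocks[OF xs False, of "snd ka"]
        compute_nr_of_jordan_blocks[OF ys False, of "snd ka"]
      by (simp add: count_mset count_list_eq_length_filter)
  qed
  then have "similar_mat (jordan_matrix xs) (jordan_matrix ys :: complex mat)"
    by (intro similar_jordan_matrix_mset multiset_eqI)
  then show "similar_mat A B"
    using xs ys similar_mat_trans similar_mat_sym unfolding jordan_nf_def by blast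
qed (rule dim_gen_eigenspace_similar)

section \<open>Rank, minors and semicontinuity of kernel dimensions\<close>

lemma index_mult_mat_sum:
  assumes "A \<in> carrier_mat r m" "B \<in> carrier_mat m c" "i < r" "j < c"
  shows "(A * B) $$ (i, j) = (\<Sum>k<m. A $$ (i, k) * B $$ (k, j))"
  using assms by (auto simp: scalar_prod_def atLeast0LessThan intro!: sum.cong)

text \<open>Gauss-Jordan elimination: \<open>C\<close> is the reduced row echelon form,
  \<open>r\<close> the rank, \<open>f\<close> lists the pivot columns, and \<open>P\<close> and
  \<open>Q\<close> are mutually inverse row operations.\<close>

lemma row_echelon_decomposition:
  fixes M :: "complex mat"
  assumes M: "M \<in> carrier_mat n n"
  obtains P Q C r f where "P \<in> carrier_mat n n" "Q \<in> carrier_mat n n" "C \<in> carrier_mat n n"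
    "C = P * M" "M = Q * C" "r + kernel_dim M = n"
    "\<And>i. i < r \<Longrightarrow> f i < n"
    "\<And>i a. i < n \<Longrightarrow> a < r \<Longrightarrow> C $$ (i, f a) = (if i = a then 1 else 0)"
    "\<And>i j. r \<le> i \<Longrightarrow> i < n \<Longrightarrow> j < n \<Longrightarrow> C $$ (i, j) = 0"
proof -
  define C where "C = gauss_jordan_single M"
  note g = gauss_jordan_single[OF M C_def[symmetric]]
  obtain P Q where PQ: "C = P * M" "P \<in> carrier_mat n n" "Q \<in> carrier_mat n n" "Q * P = 1\<^sub>m n"
    using g(4) by blast
  have C: "C \<in> carrier_mat n n" by (rule g(2))
  have "Q * C = M" using PQ M by (simp flip: assoc_mult_mat[of Q n n P n M n])
  obtain f where f: "pivot_fun C f n"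
    using g(3) C unfolding row_echelon_form_def by auto
  have dimC: "dim_row C = n" using C by simp
  note p = pivot_funD[OF dimC f]
  \<comment> \<open>A pivot function takes the value \<open>n\<close> on zero rows, so
    \<open>r\<close> is the first zero row, or \<open>n\<close> if there is none.\<close>
  define r where "r = (LEAST i. i \<ge> n \<or> f i = n)"
  have r: "r \<ge> n \<or> f r = n" unfolding r_def by (rule LeastI[of _ n]) simp
  have "r \<le> n" unfolding r_def by (rule Least_le) simp
  have less: "f i < n" if "i < r" for i
  proof -
    have "\<not> (i \<ge> n \<or> f i = n)" using not_less_Least that unfolding r_def by blast
    then show ?thesis using p(1)[of i] by auto
  qed
  have ge: "f i = n" if "r \<le> i" "i < n" for i
    using that
  proof (induction i rule: dec_induct)
    case base
    then show ?case using r by simp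
  next
    case (step i)
    then show ?case using p(3)[of i] p(1)[of "Suc i"] by auto
  qed
  have zero: "C $$ (i, j) = 0" if "r \<le> i" "i < n" "j < n" for i j
    using p(2)[of i j] ge[of i] that by simp
  have piv: "C $$ (i, f a) = (if i = a then 1 else 0)" if "i < n" "a < r" for i a
    using p(4)[of a] p(5)[of a i] less[of a] that \<open>r \<le> n\<close> by auto
  have "{i. i < n \<and> row C i \<noteq> 0\<^sub>v n} = {..<r}"
  proof (intro Set.equalityI subsetI)
    fix i assume "i \<in> {i. i < n \<and> row C i \<noteq> 0\<^sub>v n}"
    then show "i \<in> {..<r}"
      using zero C by (force intro!: eq_vecI)
  next
    fix i assume i: "i \<in> {..<r}"
    then have "row C i $ f i \<noteq> 0\<^sub>v n $ f i"
      using piv[of i i] less[of i] C \<open>r \<le> n\<close> by auto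
    then show "i \<in> {i. i < n \<and> row C i \<noteq> 0\<^sub>v n}"
      using i \<open>r \<le> n\<close> by auto
  qed
  then have "length (pivot_positions C) = r"
    using pivot_positions(4)[OF C f] by simp
  moreover interpret K: kernel n n C
    by (unfold_locales, rule C)
  have "kernel_dim M = K.dim"
    using mat_kernel_mult_eq[OF M PQ(2,3,4), folded PQ(1)] M unfolding kernel_dim_def by simp
  moreover have "K.dim = n - length (pivot_positions C)"
    using find_base_vectors(5-6)[OF g(3) C] by simp
  ultimately have "r + kernel_dim M = n"
    using \<open>r \<le> n\<close> by simp
  with PQ C \<open>Q * C = M\<close> less piv zero show thesis
    by (intro that[of P Q C r f]) auto
qed

text \<open>\<open>U\<close> consists of the first \<open>r\<close> rows of the row operation
  \<open>P\<close> and \<open>V\<close> picks the pivot columns, which makes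
  \<open>U * M * V\<close> the identity. A nonzero determinant is an open condition on
  \<open>M\<close>, as needed for semicontinuity.\<close>

lemma kernel_dim_witness:
  fixes M :: "complex mat"
  assumes M: "M \<in> carrier_mat n n"
  obtains U V r where "U \<in> carrier_mat r n" "V \<in> carrier_mat n r" "r + kernel_dim M = n"
    "det (U * M * V) \<noteq> 0"
proof -
  obtain P Q C r f where *: "P \<in> carrier_mat n n" "C \<in> carrier_mat n n" "C = P * M"
    "r + kernel_dim M = n" "\<And>i. i < r \<Longrightarrow> f i < n"
    "\<And>i a. i < n \<Longrightarrow> a < r \<Longrightarrow> C $$ (i, f a) = (if i = a then 1 else 0)"
    using row_echelon_decomposition[OF M] by metis
  have r: "r \<le> n" using *(4) by simp
  define U where "U = mat r n (\<lambda>(i, j). P $$ (i, j))"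
  define V where "V = mat n r (\<lambda>(i, j). if i = f j then 1 else 0 :: complex)"
  have UM: "(U * M) $$ (i, j) = C $$ (i, j)" if "i < r" "j < n" for i j
    using that r *(1,3) M by (auto simp: U_def scalar_prod_def intro!: sum.cong)
  have "U * M * V = 1\<^sub>m r"
  proof (rule eq_matI)
    fix i j assume "i < dim_row (1\<^sub>m r :: complex mat)" "j < dim_col (1\<^sub>m r :: complex mat)"
    then have ij: "i < r" "j < r" by simp_all
    have "(U * M * V) $$ (i, j) = (\<Sum>k\<in>{0..<n}. (U * M) $$ (i, k) * (if k = f j then 1 else 0))"
      using ij M by (auto simp: U_def V_def scalar_prod_def intro!: sum.cong)
    also have "\<dots> = (U * M) $$ (i, f j)"
      using *(5)[OF ij(2)] by (simp add: if_distrib sum.delta cong: if_cong)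
    also have "\<dots> = 1\<^sub>m r $$ (i, j)"
      using ij UM[OF ij(1) *(5)[OF ij(2)]] *(6)[of i j] r by simp
    finally show "(U * M * V) $$ (i, j) = 1\<^sub>m r $$ (i, j)" .
  qed (auto simp: U_def V_def)
  with * show thesis
    by (intro that[of U r V]) (auto simp: U_def V_def)
qed

text \<open>\<open>M\<close> factors through a space of dimension its rank \<open>r\<close>, so
  \<open>U * M * V\<close> is singular if its size \<open>s\<close> exceeds
  \<open>r\<close>.\<close>

lemma kernel_dim_bound:
  fixes M :: "complex mat"
  assumes M: "M \<in> carrier_mat n n" and U: "U \<in> carrier_mat s n" and V: "V \<in> carrier_mat n s"
    and det: "det (U * M * V) \<noteq> 0"
  shows "s + kernel_dim M \<le> n"
proof (rule ccontr)
  assume neg: "\<not> s + kernel_dim M \<le> n"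
  obtain Q C r where *: "Q \<in> carrier_mat n n" "C \<in> carrier_mat n n" "M = Q * C" "r + kernel_dim M = n"
    "\<And>i j. r \<le> i \<Longrightarrow> i < n \<Longrightarrow> j < n \<Longrightarrow> C $$ (i, j) = 0"
    using row_echelon_decomposition[OF M] by metis
  have rs: "r < s" using neg *(4) by simp
  define X' where "X' = U * Q"
  define Z' where "Z' = C * V"
  have Xc: "X' \<in> carrier_mat s n" and Zc: "Z' \<in> carrier_mat n s"
    using * U V by (auto simp: X'_def Z'_def)
  \<comment> \<open>Only the first \<open>r\<close> inner indices contribute, so both factors may be
    cut or padded with zeros to size \<open>s\<close>. Multiplicativity of the determinant then
    applies, and the last row of \<open>Z\<close> is zero.\<close>
  define X where "X = mat s s (\<lambda>(i, j). if j < n then X' $$ (i, j) else 0)"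
  define Z where "Z = mat s s (\<lambda>(i, j). if i < n then Z' $$ (i, j) else 0)"
  have zero: "Z' $$ (i, j) = 0" if "r \<le> i" "i < n" "j < s" for i j
    using that *(5) index_mult_mat_sum[OF *(2) V that(2,3)] by (simp add: Z'_def)
  have "U * M * V = X' * Z'"
    using *(1,2,3) U V assoc_mult_mat[of U s n Q n C n] assoc_mult_mat[of "U * Q" s n C n V s]
    by (simp add: X'_def Z'_def)
  also have "\<dots> = X * Z"
  proof (rule eq_matI)
    fix i j assume "i < dim_row (X * Z)" "j < dim_col (X * Z)"
    then have ij: "i < s" "j < s" by (auto simp: X_def Z_def)
    have "(X' * Z') $$ (i, j) = (\<Sum>k<n. X' $$ (i, k) * Z' $$ (k, j))"
      by (rule index_mult_mat_sum[OF Xc Zc ij])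
    also have "\<dots> = (\<Sum>k<r. X' $$ (i, k) * Z' $$ (k, j))"
      using zero ij *(4) by (intro sum.mono_neutral_right) (auto simp: not_less)
    also have "\<dots> = (\<Sum>k<r. X $$ (i, k) * Z $$ (k, j))"
      using ij rs *(4) by (intro sum.cong) (auto simp: X_def Z_def)
    also have "\<dots> = (\<Sum>k<s. X $$ (i, k) * Z $$ (k, j))"
      using zero ij rs by (intro sum.mono_neutral_left) (auto simp: Z_def not_less)
    also have "\<dots> = (X * Z) $$ (i, j)"
      by (rule index_mult_mat_sum[symmetric]) (use ij in \<open>auto simp: X_def Z_def\<close>)
    finally show "(X' * Z') $$ (i, j) = (X * Z) $$ (i, j)" .
  qed (use Xc Zc in \<open>auto simp: X_def Z_def\<close>)
  finally have "det (U * M * V) = det X * det Z"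
    using det_mult[of X s Z] by (simp add: X_def Z_def)
  moreover have "det Z = 0"
  proof -
    have "Z $$ (s - 1, p (s - 1)) = 0" if "p permutes {0..<s}" for p
      using zero[of "s - 1" "p (s - 1)"] rs permutes_in_image[OF that, of "s - 1"]
      by (auto simp: Z_def)
    then have "(\<Prod>i\<in>{0..<s}. Z $$ (i, p i)) = 0" if "p permutes {0..<s}" for p
      using that rs by (intro prod_zero[OF _ bexI[of _ "s - 1"]]) auto
    then show ?thesis
      using det_def'[of Z s] by (auto simp: Z_def intro!: sum.neutral)
  qed
  ultimately show False using det by simp
qed

text \<open>The determinant from \<open>kernel_dim_witness\<close> for the power belonging to
  \<open>A\<close>, read as a polynomial in the matrix, is the required \<open>f\<close>: where it
  does not vanish, the rank is at least that at \<open>A\<close>.\<close>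

lemma dim_gen_eigenspace_semicontinuous:
  fixes A :: "complex mat"
  assumes A: "A \<in> carrier_mat n n"
  shows "\<exists>f\<in>polynomial_functions n. f A \<noteq> 0 \<and>
    (\<forall>B\<in>carrier_mat n n. f B \<noteq> 0 \<longrightarrow> dim_gen_eigenspace B ev k \<le> dim_gen_eigenspace A ev k)"
proof -
  have "char_matrix A ev ^\<^sub>m k \<in> carrier_mat n n" using A by simp
  then obtain U V r where UV: "U \<in> carrier_mat r n" "V \<in> carrier_mat n r"
    "r + kernel_dim (char_matrix A ev ^\<^sub>m k) = n" "det (U * char_matrix A ev ^\<^sub>m k * V) \<noteq> 0"
    by (rule kernel_dim_witness)
  define f where "f = (\<lambda>X. det (U * char_matrix (trunc n X) ev ^\<^sub>m k * V))"
  have "(\<lambda>X. char_matrix (trunc n X) ev) = (\<lambda>X. trunc n X + (- ev) \<cdot>\<^sub>m 1\<^sub>m n)"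
    by (simp add: char_matrix_def trunc_def)
  then have "(\<lambda>X. char_matrix (trunc n X) ev) \<in> polynomial_functions.matrices n n n"
    using polynomial_functions.matrices_add[OF trunc_mem polynomial_functions.matrices_const,
        of "(- ev) \<cdot>\<^sub>m 1\<^sub>m n" n] by simp
  then have "f \<in> polynomial_functions n"
    unfolding f_def
    by (rule polynomial_functions.det_mem[OF polynomial_functions.matrices_mult[OF
          polynomial_functions.matrices_mult[OF polynomial_functions.matrices_const[OF UV(1)]
          polynomial_functions.matrices_pow] polynomial_functions.matrices_const[OF UV(2)]]])
  moreover have "f A \<noteq> 0" using UV A by (simp add: f_def)
  moreover have "dim_gen_eigenspace B ev k \<le> dim_gen_eigenspace A ev k"
    if B: "B \<in> carrier_mat n n" and "f B \<noteq> 0" for B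
    using kernel_dim_bound[of "char_matrix B ev ^\<^sub>m k" n U r V] UV that
    by (simp add: f_def dim_gen_eigenspace_def)
  ultimately show ?thesis by blast
qed

section \<open>Strictly upper triangular matrices and their generic similarity class\<close>

definition strictly_upper :: "nat \<Rightarrow> complex mat set" where
  "strictly_upper n = {X \<in> carrier_mat n n. \<forall>i<n. \<forall>j<n. X $$ (i, j) \<noteq> 0 \<longrightarrow> i < j}"

lemma strictly_upper_carrier: "X \<in> strictly_upper n \<Longrightarrow> X \<in> carrier_mat n n"
  by (simp add: strictly_upper_def)

lemma strictly_upper_zero: "X \<in> strictly_upper n \<Longrightarrow> i < n \<Longrightarrow> j \<le> i \<Longrightarrow> X $$ (i, j) = 0"
proof (rule ccontr)
  assume *: "X \<in> strictly_upper n" "i < n" "j \<le> i" "X $$ (i, j) \<noteq> 0"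
  then have "i < j" unfolding strictly_upper_def by fastforce
  with * show False by simp
qed

lemma strictly_upper_sl: "strictly_upper n \<subseteq> sl n"
  by (auto simp: sl_def strictly_upper_zero strictly_upper_carrier)

lemma strictly_upper_pow:
  assumes X: "X \<in> strictly_upper n" and "i < n" "j < n" "j < i + k"
  shows "(X ^\<^sub>m k) $$ (i, j) = 0"
  using assms(2-)
proof (induction k arbitrary: j)
  case 0
  then show ?case using strictly_upper_carrier[OF X] by auto
next
  case (Suc k)
  note C = strictly_upper_carrier[OF X]
  have "(X ^\<^sub>m Suc k) $$ (i, j) = (\<Sum>m<n. (X ^\<^sub>m k) $$ (i, m) * X $$ (m, j))"
    using index_mult_mat_sum[of "X ^\<^sub>m k" n n X n i j] C Suc.prems by simp
  also have "\<dots> = 0"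
  proof (intro sum.neutral ballI)
    fix m assume m: "m \<in> {..<n}"
    show "(X ^\<^sub>m k) $$ (i, m) * X $$ (m, j) = 0"
    proof (cases "m < i + k")
      case True
      then show ?thesis using Suc.IH[of m] Suc.prems m by simp
    next
      case False
      then show ?thesis using strictly_upper_zero[OF X, of m j] Suc.prems m by simp
    qed
  qed
  finally show ?case .
qed

lemma strictly_upper_nilpotent:
  assumes "X \<in> strictly_upper n" "n \<le> k"
  shows "X ^\<^sub>m k = 0\<^sub>m n n"
  using strictly_upper_pow[OF assms(1)] strictly_upper_carrier[OF assms(1)] assms(2)
  by (intro eq_matI) auto

text \<open>\<open>X - ev\<close> is upper triangular with diagonal entries \<open>- ev\<close>,
  hence invertible. Only the eigenvalue 0 remains to be compared.\<close>

lemma dim_gen_eigenspace_strictly_upper: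
  assumes X: "X \<in> strictly_upper n" and "ev \<noteq> 0"
  shows "dim_gen_eigenspace X ev k = 0"
proof -
  note C = strictly_upper_carrier[OF X]
  let ?M = "char_matrix X ev"
  have M: "?M \<in> carrier_mat n n" using C by simp
  have "upper_triangular ?M"
    using C strictly_upper_zero[OF X] by (auto simp: char_matrix_def upper_triangular_def)
  then have "det ?M = prod_list (diag_mat ?M)" using det_upper_triangular[OF _ M] by blast
  moreover have "0 \<notin> set (diag_mat ?M)"
    using C strictly_upper_zero[OF X] \<open>ev \<noteq> 0\<close> by (auto simp: char_matrix_def diag_mat_def)
  ultimately have "det ?M \<noteq> 0" by (simp add: prod_list_zero_iff)
  then have "det (?M ^\<^sub>m k) \<noteq> 0"
    by (induction k) (use M in \<open>auto simp: det_mult[of _ n]\<close>)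
  then show ?thesis
    using kernel_dim_bound[of "?M ^\<^sub>m k" n "1\<^sub>m n" n "1\<^sub>m n"] M
    by (simp add: dim_gen_eigenspace_def)
qed

text \<open>Choose \<open>X\<close> with the least total kernel dimension of its powers up to
  \<open>n\<close>. On the open set given by semicontinuity no kernel dimension exceeds that of
  \<open>X\<close>, so by minimality all agree. Powers beyond \<open>n\<close> vanish, and equal
  kernel dimensions mean similarity.\<close>

lemma strictly_upper_generic_orbit:
  assumes L: "L \<subseteq> strictly_upper n" "L \<noteq> {}"
  obtains X h where "X \<in> L" "h \<in> polynomial_functions n" "h X \<noteq> 0"
    "\<And>Y. Y \<in> L \<Longrightarrow> h Y \<noteq> 0 \<Longrightarrow> similar_mat Y X"
proof -
  let ?d = "\<lambda>X :: complex mat. dim_gen_eigenspace X 0"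
  obtain X where X: "X \<in> L" and min: "\<And>Y. Y \<in> L \<Longrightarrow> (\<Sum>k\<le>n. ?d X k) \<le> (\<Sum>k\<le>n. ?d Y k)"
    using L(2) ex_has_least_nat[of "\<lambda>X. X \<in> L" _ "\<lambda>X. \<Sum>k\<le>n. ?d X k"] by blast
  have C: "Y \<in> carrier_mat n n" if "Y \<in> L" for Y
    using that L(1) strictly_upper_carrier by blast
  have "\<forall>k. \<exists>f\<in>polynomial_functions n. f X \<noteq> 0 \<and>
    (\<forall>B\<in>carrier_mat n n. f B \<noteq> 0 \<longrightarrow> ?d B k \<le> ?d X k)"
    using dim_gen_eigenspace_semicontinuous[OF C[OF X]] by blast
  then obtain f where f: "\<And>k. f k \<in> polynomial_functions n" "\<And>k. f k X \<noteq> 0"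
    "\<And>k B. B \<in> carrier_mat n n \<Longrightarrow> f k B \<noteq> 0 \<Longrightarrow> ?d B k \<le> ?d X k"
    by metis
  define h where "h = (\<lambda>Y. \<Prod>k\<le>n. f k Y)"
  have "h \<in> polynomial_functions n"
    unfolding h_def by (intro polynomial_functions.prod_mem f)
  moreover have "h X \<noteq> 0" using f(2) by (simp add: h_def)
  moreover have "similar_mat Y X" if Y: "Y \<in> L" and "h Y \<noteq> 0" for Y
  proof -
    have le: "?d Y k \<le> ?d X k" if "k \<le> n" for k
      using f(3)[OF C[OF Y], of k] \<open>h Y \<noteq> 0\<close> that by (simp add: h_def)
    have eq: "?d Y k = ?d X k" if "k \<le> n" for k
    proof (rule ccontr)
      assume "?d Y k \<noteq> ?d X k"
      then have "(\<Sum>k\<le>n. ?d Y k) < (\<Sum>k\<le>n. ?d X k)"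
        using le that by (intro sum_strict_mono_ex1 bexI[of _ k]) (auto simp: order_le_less)
      then show False using min[OF Y] by simp
    qed
    have "dim_gen_eigenspace Y ev k = dim_gen_eigenspace X ev k" for ev k
    proof (cases "ev = 0")
      case False
      then show ?thesis
        using dim_gen_eigenspace_strictly_upper[OF subsetD[OF L(1) X]]
          dim_gen_eigenspace_strictly_upper[OF subsetD[OF L(1) Y]] by simp
    next
      case True
      have "char_matrix Z 0 = Z" if "Z \<in> L" for Z
        using C[OF that] by (intro eq_matI) (auto simp: char_matrix_def)
      then have "?d Y k = ?d X k" if "n < k"
        using strictly_upper_nilpotent[OF subsetD[OF L(1) X], of k]
          strictly_upper_nilpotent[OF subsetD[OF L(1) Y], of k] X Y that
        by (simp add: dim_gen_eigenspace_def)
      then show ?thesis using eq True by (cases "k \<le> n") auto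
    qed
    then show ?thesis
      using similar_iff_dim_gen_eigenspace[OF C[OF Y] C[OF X]] by auto
  qed
  ultimately show thesis using that X by blast
qed

section \<open>Orbits and orbital varieties\<close>

lemma similar_mat_wit_carrier:
  "similar_mat_wit A X g h \<Longrightarrow> X \<in> carrier_mat n n \<Longrightarrow> A \<in> carrier_mat n n"
  by (drule similar_mat_wit_sym) (rule similar_mat_witD2(5))

text \<open>Scaling \<open>g\<close> by an \<open>n\<close>-th root of \<open>1 / det g\<close>
  gives determinant 1 and leaves the conjugation unchanged. Similarity classes are therefore orbits
  of \<open>SL n\<close>.\<close>

lemma similar_mat_wit_SL:
  assumes wit: "similar_mat_wit A X g h" and A: "A \<in> carrier_mat n n"
  obtains c where "c \<noteq> 0" "c \<cdot>\<^sub>m g \<in> SL n" "similar_mat_wit A X (c \<cdot>\<^sub>m g) (inverse c \<cdot>\<^sub>m h)"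
proof -
  note w = similar_mat_witD2[OF A wit]
  have "det g * det h = 1" using det_mult[OF w(6,7)] w(1) by simp
  then have "det g \<noteq> 0" by auto
  obtain c where c: "c \<noteq> 0" "c ^ n * det g = 1"
  proof (cases "n = 0")
    case True
    then show ?thesis using that[of 1] w(6) by simp
  next
    case False
    define c where "c = rcis (root n (cmod (inverse (det g)))) (Arg (inverse (det g)) / n)"
    have "c ^ n = inverse (det g)"
      using False rcis_cmod_Arg[of "inverse (det g)"] by (simp add: c_def DeMoivre2)
    moreover from this have "c \<noteq> 0" using \<open>det g \<noteq> 0\<close> False by (auto simp: zero_power)
    ultimately show ?thesis using that[of c] \<open>det g \<noteq> 0\<close> by auto
  qed
  have "c \<cdot>\<^sub>m g \<in> SL n" using c w by (simp add: SL_def)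
  moreover have "similar_mat_wit A X (c \<cdot>\<^sub>m g) (inverse c \<cdot>\<^sub>m h)"
  proof (rule similar_mat_witI[where n = n])
    have s: "c \<cdot>\<^sub>m (inverse c \<cdot>\<^sub>m M) = M" "inverse c \<cdot>\<^sub>m (c \<cdot>\<^sub>m M) = M" for M :: "complex mat"
      using c(1) by (auto intro!: eq_matI)
    have mult: "(c \<cdot>\<^sub>m M) * (inverse c \<cdot>\<^sub>m N) = M * N" "(inverse c \<cdot>\<^sub>m N) * (c \<cdot>\<^sub>m M) = N * M"
      if "M \<in> carrier_mat n n" "N \<in> carrier_mat n n" for M N
      using that mult_smult_distrib[of "c \<cdot>\<^sub>m M" n n N n "inverse c"]
        mult_smult_assoc_mat[of M n n N n c] mult_smult_distrib[of "inverse c \<cdot>\<^sub>m N" n n M n c]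
        mult_smult_assoc_mat[of N n n M n "inverse c"] s
      by simp_all
    show "(c \<cdot>\<^sub>m g) * (inverse c \<cdot>\<^sub>m h) = 1\<^sub>m n" "(inverse c \<cdot>\<^sub>m h) * (c \<cdot>\<^sub>m g) = 1\<^sub>m n"
      using mult[OF w(6,7)] w(1,2) by simp_all
    have "(c \<cdot>\<^sub>m g) * X = c \<cdot>\<^sub>m (g * X)" using mult_smult_assoc_mat[OF w(6,5)] .
    then show "A = (c \<cdot>\<^sub>m g) * X * (inverse c \<cdot>\<^sub>m h)"
      using mult(1)[of "g * X" h] w by simp
  qed (use w in auto)
  ultimately show thesis using that c by blast
qed

lemma SL_orbit_iff:
  assumes "X \<in> carrier_mat n n"
  shows "A \<in> saturation (SL n) {X} \<longleftrightarrow> similar_mat A X"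
proof
  assume "similar_mat A X"
  then obtain g h where wit: "similar_mat_wit A X g h" by (auto simp: similar_mat_def)
  have "A \<in> carrier_mat n n"
    by (rule similar_mat_wit_carrier[OF wit assms])
  from similar_mat_wit_SL[OF wit this] show "A \<in> saturation (SL n) {X}"
    by (auto intro: saturationI)
qed (auto simp: saturation_def similar_mat_def)

lemma upper_triangular_mult:
  assumes "A \<in> carrier_mat n n" "B \<in> carrier_mat n n" "upper_triangular A" "upper_triangular B"
  shows "upper_triangular (A * (B :: 'a :: semiring_0 mat))"
proof (rule upper_triangularI)
  fix i j assume ij: "j < i" "i < dim_row (A * B)"
  have "A $$ (i, k) * B $$ (k, j) = 0" if "k < n" for k
    using assms ij that by (cases "k < i") (auto simp: upper_triangular_def)
  then show "(A * B) $$ (i, j) = 0"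
    using index_mult_mat_sum[OF assms(1,2), of i j] ij assms(1) by auto
qed

lemma SL_mult: "g \<in> SL n \<Longrightarrow> h \<in> SL n \<Longrightarrow> g * h \<in> SL n"
  by (auto simp: SL_def det_mult[of _ n])

lemma Borel_mult: "g \<in> Borel n \<Longrightarrow> h \<in> Borel n \<Longrightarrow> g * h \<in> Borel n"
  using SL_mult upper_triangular_mult[of g n h] by (auto simp: Borel_def SL_def)

lemma one_Borel: "1\<^sub>m n \<in> Borel n"
  by (auto simp: Borel_def SL_def)

lemma saturation_idem:
  assumes "\<And>g h. g \<in> H \<Longrightarrow> h \<in> H \<Longrightarrow> g * h \<in> H"
  shows "saturation H (saturation H S) \<subseteq> saturation H S"
proof
  fix A assume "A \<in> saturation H (saturation H S)"
  then obtain B X g h g' h' where "X \<in> S" "g \<in> H" "g' \<in> H"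
    "similar_mat_wit A B g h" "similar_mat_wit B X g' h'"
    unfolding saturation_def by blast
  then show "A \<in> saturation H S"
    by (intro saturationI[OF _ _ similar_mat_wit_trans] assms)
qed

lemma saturation_mono: "G \<subseteq> H \<Longrightarrow> S \<subseteq> T \<Longrightarrow> saturation G S \<subseteq> saturation H T"
  unfolding saturation_def by blast

lemma Borel_subset_SL: "Borel n \<subseteq> SL n"
  by (auto simp: Borel_def)

lemma saturation_Borel_incl: "S \<subseteq> carrier_mat n n \<Longrightarrow> S \<subseteq> saturation (Borel n) S"
  by (auto intro: saturationI[OF _ one_Borel similar_mat_wit_refl])

text \<open>\<open>X\<close> lies in the closure of the orbit of \<open>Y\<close>, so an open set on
  which a kernel dimension is at most that of \<open>X\<close> meets this orbit. By symmetry all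
  kernel dimensions agree. This makes the orbit in \<open>orbit_of_perm\<close> unique.\<close>

lemma zariski_closure_orbit_inj:
  assumes X: "X \<in> sl n" and Y: "Y \<in> sl n"
    and eq: "zariski_closure n (saturation (SL n) {X}) = zariski_closure n (saturation (SL n) {Y})"
  shows "similar_mat X Y"
proof -
  have le: "dim_gen_eigenspace Y ev k \<le> dim_gen_eigenspace X ev k"
    if X: "X \<in> sl n" and Y: "Y \<in> sl n"
      and eq: "zariski_closure n (saturation (SL n) {X}) = zariski_closure n (saturation (SL n) {Y})"
    for X Y ev k
  proof -
    note C = sl_carrier[OF X] sl_carrier[OF Y]
    obtain f where f: "f \<in> polynomial_functions n" "f X \<noteq> 0"
      "\<And>B. B \<in> carrier_mat n n \<Longrightarrow> f B \<noteq> 0 \<Longrightarrow> dim_gen_eigenspace B ev k \<le> dim_gen_eigenspace X ev k"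
      using dim_gen_eigenspace_semicontinuous[OF C(1), of ev k] by blast
    have "X \<in> saturation (SL n) {X}"
      using SL_orbit_iff[OF C(1)] similar_mat_refl[OF C(1)] by blast
    then have "X \<in> zariski_closure n (saturation (SL n) {Y})"
      using zariski_closure_incl[OF saturation_sl] X unfolding eq[symmetric] by blast
    then obtain B where B: "B \<in> saturation (SL n) {Y}" "f B \<noteq> 0"
      using zariski_closureD[OF _ f(1)] f(2) by blast
    then have sim: "similar_mat B Y" using SL_orbit_iff[OF C(2)] by blast
    then have "B \<in> carrier_mat n n"
      using C(2) similar_mat_wit_carrier unfolding similar_mat_def by blast
    then show ?thesis using f(3)[OF _ B(2)] dim_gen_eigenspace_similar[OF sim] by simp
  qed
  have "dim_gen_eigenspace X = dim_gen_eigenspace Y"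
    using le[OF X Y eq] le[OF Y X eq[symmetric]] by (intro ext antisym) blast+
  then show ?thesis
    using similar_iff_dim_gen_eigenspace X Y sl_carrier by blast
qed

section \<open>The linear spaces \<open>n_cap_conj\<close> and their Borel closures\<close>

lemma n_cap_conj_iff:
  "X \<in> n_cap_conj n w \<longleftrightarrow> X \<in> carrier_mat n n \<and>
    (\<forall>i<n. \<forall>j<n. X $$ (i, j) \<noteq> 0 \<longrightarrow> i < j \<and> Hilbert_Choice.inv w i < Hilbert_Choice.inv w j)"
proof
  assume X: "X \<in> carrier_mat n n \<and>
    (\<forall>i<n. \<forall>j<n. X $$ (i, j) \<noteq> 0 \<longrightarrow> i < j \<and> Hilbert_Choice.inv w i < Hilbert_Choice.inv w j)"
  then have "X = mat n n (\<lambda>(i, j). if i < j \<and> Hilbert_Choice.inv w i < Hilbert_Choice.inv w j then X $$ (i, j) else 0)"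
    by (intro eq_matI) auto
  then show "X \<in> n_cap_conj n w"
    unfolding n_cap_conj_def by (auto intro!: exI[of _ "\<lambda>i j. X $$ (i, j)"])
qed (auto simp: n_cap_conj_def split: if_splits)

lemma n_cap_conj_strictly_upper: "n_cap_conj n w \<subseteq> strictly_upper n"
  by (auto simp: n_cap_conj_iff strictly_upper_def)

lemma n_cap_conj_sl: "n_cap_conj n w \<subseteq> sl n"
  using n_cap_conj_strictly_upper strictly_upper_sl by blast

lemma zero_n_cap_conj: "0\<^sub>m n n \<in> n_cap_conj n w"
  by (auto simp: n_cap_conj_iff)

lemma line_n_cap_conj:
  assumes A: "A \<in> n_cap_conj n w" and B: "B \<in> n_cap_conj n w"
  shows "line A B t \<in> n_cap_conj n w"
proof -
  have C: "A \<in> carrier_mat n n" "B \<in> carrier_mat n n" using A B n_cap_conj_iff by blast+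
  have "i < j \<and> Hilbert_Choice.inv w i < Hilbert_Choice.inv w j"
    if ij: "i < n" "j < n" and "line A B t $$ (i, j) \<noteq> 0" for i j
  proof -
    have "A $$ (i, j) \<noteq> 0 \<or> B $$ (i, j) \<noteq> 0"
      using that C by (auto simp: line_def)
    then show ?thesis using A B ij unfolding n_cap_conj_iff by blast
  qed
  moreover have "line A B t \<in> carrier_mat n n" using C by (auto simp: line_def)
  ultimately show ?thesis unfolding n_cap_conj_iff by blast
qed

text \<open>The set \<open>C\<^sub>w\<close> of the overview, not yet intersected with an
  orbit.\<close>

definition borel_closure :: "nat \<Rightarrow> (nat \<Rightarrow> nat) \<Rightarrow> complex mat set" where
  "borel_closure n w = zariski_closure n (saturation (Borel n) (n_cap_conj n w))"

lemma borel_closure_sl: "borel_closure n w \<subseteq> sl n"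
  by (simp add: borel_closure_def zariski_closure_sl)

lemma n_cap_conj_borel_closure: "n_cap_conj n w \<subseteq> borel_closure n w"
  unfolding borel_closure_def
  using saturation_Borel_incl[of "n_cap_conj n w" n] n_cap_conj_sl sl_carrier
    zariski_closure_incl[OF saturation_sl[OF n_cap_conj_sl]] by blast

lemma saturation_borel_closure: "saturation (Borel n) (borel_closure n w) \<subseteq> borel_closure n w"
  unfolding borel_closure_def
  by (intro saturation_zariski_closure order_trans[OF saturation_idem[OF Borel_mult]]
      zariski_closure_incl saturation_sl n_cap_conj_sl)

text \<open>The orbit of a generic \<open>X\<close> contains a dense part of the linear space, so
  its closure equals that of the whole saturation. Orbits with the same closure coincide, which
  resolves the description in \<open>orbit_of_perm\<close>.\<close>

lemma orbit_of_perm_generic: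
  obtains X h where "X \<in> n_cap_conj n w" "h \<in> polynomial_functions n" "h X \<noteq> 0"
    "\<And>Y. Y \<in> n_cap_conj n w \<Longrightarrow> h Y \<noteq> 0 \<Longrightarrow> similar_mat Y X"
    "orbit_of_perm n w = saturation (SL n) {X}"
proof -
  let ?N = "n_cap_conj n w" and ?zc = "zariski_closure n"
  obtain X h where X: "X \<in> ?N" "h \<in> polynomial_functions n" "h X \<noteq> 0"
    and sim: "\<And>Y. Y \<in> ?N \<Longrightarrow> h Y \<noteq> 0 \<Longrightarrow> similar_mat Y X"
    using strictly_upper_generic_orbit[OF n_cap_conj_strictly_upper, of n w] zero_n_cap_conj by blast
  let ?O = "saturation (SL n) {X}"
  have Xsl: "X \<in> sl n" using X(1) n_cap_conj_sl by blast
  have O_zc: "?O \<subseteq> ?zc ?O" using Xsl by (intro zariski_closure_incl saturation_sl) simp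
  have "?N \<subseteq> ?zc ?O"
    by (rule affine_subset_zariski_closure[OF n_cap_conj_sl line_n_cap_conj X(2,1,3)])
      (use sim SL_orbit_iff[OF sl_carrier[OF Xsl]] O_zc in blast)+
  moreover have "saturation (SL n) (?zc ?O) \<subseteq> ?zc ?O"
    using saturation_idem[of "SL n" "{X}"] SL_mult O_zc Xsl
    by (intro saturation_zariski_closure saturation_sl) auto
  ultimately have "saturation (SL n) ?N \<subseteq> ?zc ?O" by (rule saturation_minimal)
  moreover have "?O \<subseteq> ?zc (saturation (SL n) ?N)"
    using saturation_mono[of "SL n" "SL n" "{X}" ?N] X(1)
      zariski_closure_incl[OF saturation_sl[OF n_cap_conj_sl]] by blast
  ultimately have eq: "?zc ?O = ?zc (saturation (SL n) ?N)"
    by (metis antisym zariski_closure_minimal)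
  have O: "?O \<in> nilpotent_orbits n"
    using Xsl X(1) n_cap_conj_strictly_upper strictly_upper_nilpotent[of X n n]
    unfolding nilpotent_orbits_def by blast
  have "orbit_of_perm n w = ?O"
    unfolding orbit_of_perm_def
  proof (rule the_equality)
    show "?O \<in> nilpotent_orbits n \<and> ?zc ?O = ?zc (saturation (SL n) ?N)" using O eq by blast
    fix Orb assume Orb: "Orb \<in> nilpotent_orbits n \<and> ?zc Orb = ?zc (saturation (SL n) ?N)"
    then obtain Y where Y: "Y \<in> sl n" "Orb = saturation (SL n) {Y}"
      unfolding nilpotent_orbits_def by blast
    have XY: "similar_mat X Y"
      by (rule zariski_closure_orbit_inj[OF Xsl Y(1)]) (use eq Orb Y(2) in simp)
    then show "Orb = ?O"
      unfolding Y(2) set_eq_iff SL_orbit_iff[OF sl_carrier[OF Xsl]] SL_orbit_iff[OF sl_carrier[OF Y(1)]]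
      using similar_mat_trans similar_mat_sym by blast
  qed
  with that X sim show thesis by blast
qed

text \<open>Intersecting with the orbit keeps the generic elements of \<open>n_cap_conj n w\<close>,
  which are dense in this space, and the intersection is still Borel-stable.\<close>

lemma zariski_closure_orbital_variety:
  "zariski_closure n (orbital_variety n w) = borel_closure n w"
proof -
  let ?N = "n_cap_conj n w" and ?V = "orbital_variety n w" and ?zc = "zariski_closure n"
  obtain X h where X: "X \<in> ?N" "h \<in> polynomial_functions n" "h X \<noteq> 0"
    and sim: "\<And>Y. Y \<in> ?N \<Longrightarrow> h Y \<noteq> 0 \<Longrightarrow> similar_mat Y X"
    and orb: "orbit_of_perm n w = saturation (SL n) {X}"
    using orbit_of_perm_generic[of n w] by blast
  have Xsl: "X \<in> sl n" using X(1) n_cap_conj_sl by blast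
  have V: "?V = borel_closure n w \<inter> saturation (SL n) {X}"
    unfolding orbital_variety_def borel_closure_def orb ..
  have V_sl: "?V \<subseteq> sl n" using V borel_closure_sl by blast
  have "?N \<subseteq> ?zc ?V"
  proof (rule affine_subset_zariski_closure[OF n_cap_conj_sl line_n_cap_conj X(2,1,3)])
    fix Y assume Y: "Y \<in> ?N" "h Y \<noteq> 0"
    then have "Y \<in> ?V"
      unfolding V using sim SL_orbit_iff[OF sl_carrier[OF Xsl]] n_cap_conj_borel_closure by blast
    then show "Y \<in> ?zc ?V" using zariski_closure_incl[OF V_sl] by blast
  qed
  moreover have "saturation (Borel n) ?V \<subseteq> ?V"
    unfolding V
    by (intro Int_greatest
        order_trans[OF saturation_mono[OF order_refl Int_lower1] saturation_borel_closure]
        order_trans[OF saturation_mono[OF Borel_subset_SL Int_lower2] saturation_idem[OF SL_mult]])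
  then have "saturation (Borel n) (?zc ?V) \<subseteq> ?zc ?V"
    using zariski_closure_incl[OF V_sl] by (intro saturation_zariski_closure[OF V_sl]) blast
  ultimately have "borel_closure n w \<subseteq> ?zc ?V"
    unfolding borel_closure_def by (rule zariski_closure_minimal[OF saturation_minimal])
  moreover have "?zc ?V \<subseteq> borel_closure n w"
    unfolding borel_closure_def
    by (rule zariski_closure_minimal) (use V in \<open>simp add: borel_closure_def\<close>)
  ultimately show ?thesis by blast
qed

text \<open>\<open>borel_closure n y\<close> is closed and Borel-stable, so it is enough that it
  contains a linear space generating the other closure.\<close>

lemma orbital_variety_subset_iff:
  "orbital_variety n w \<subseteq> zariski_closure n (orbital_variety n y) \<longleftrightarrow>
    n_cap_conj n w \<subseteq> borel_closure n y"
proof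
  assume "orbital_variety n w \<subseteq> zariski_closure n (orbital_variety n y)"
  then have "zariski_closure n (orbital_variety n w) \<subseteq> zariski_closure n (orbital_variety n y)"
    by (rule zariski_closure_minimal)
  then show "n_cap_conj n w \<subseteq> borel_closure n y"
    using n_cap_conj_borel_closure unfolding zariski_closure_orbital_variety by blast
next
  assume "n_cap_conj n w \<subseteq> borel_closure n y"
  then have "borel_closure n w \<subseteq> borel_closure n y"
    using saturation_minimal[OF _ saturation_borel_closure, of "n_cap_conj n w" n y]
    unfolding borel_closure_def by - (rule zariski_closure_minimal)
  moreover have "orbital_variety n w \<subseteq> borel_closure n w"
    unfolding orbital_variety_def borel_closure_def by blast
  ultimately show "orbital_variety n w \<subseteq> zariski_closure n (orbital_variety n y)"
    unfolding zariski_closure_orbital_variety by blast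
qed

section \<open>Minimal parabolic subgroups\<close>

lemma simple_reflection_apply:
  "simple_reflection k i = (if i = k then k + 1 else if i = k + 1 then k else i)"
  by (simp add: simple_reflection_def Transposition.transpose_def)

lemma simple_reflection_involution [simp]: "simple_reflection k (simple_reflection k i) = i"
  by (simp add: simple_reflection_def)

lemma simple_reflection_less: "k + 1 < n \<Longrightarrow> i < n \<Longrightarrow> simple_reflection k i < n"
  by (simp add: simple_reflection_apply)

text \<open>A simple reflection permutes the positive roots other than its own simple root.\<close>

lemma simple_reflection_less_iff:
  "(simple_reflection k i, simple_reflection k j) \<noteq> (k, k + 1) \<Longrightarrow>
    simple_reflection k i < simple_reflection k j \<Longrightarrow> i < j"
  by (auto simp: simple_reflection_apply split: if_splits)

text \<open>An element of the root subgroup of the negative of the simple root with index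
  \<open>k\<close>.\<close>

definition lower_mat :: "nat \<Rightarrow> nat \<Rightarrow> complex \<Rightarrow> complex mat" where
  "lower_mat n k t = mat n n (\<lambda>(i, j). (if i = j then 1 else 0) + (if i = k + 1 \<and> j = k then t else 0))"

text \<open>Conjugation by \<open>lower_mat n k t\<close>, written out by entries so that it is
  visibly polynomial in \<open>t\<close> and \<open>X\<close>. The nested term is the row operation
  already applied to the column \<open>k + 1\<close>.\<close>

definition lower_conj :: "nat \<Rightarrow> nat \<Rightarrow> complex \<Rightarrow> complex mat \<Rightarrow> complex mat" where
  "lower_conj n k t X = mat n n (\<lambda>(i, j). X $$ (i, j) + (if i = k + 1 then t * X $$ (k, j) else 0) -
     (if j = k then t * (X $$ (i, k + 1) + (if i = k + 1 then t * X $$ (k, k + 1) else 0)) else 0))"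

text \<open>For \<open>k + 1 < n\<close> this permutation matrix has determinant -1 and lies outside
  \<open>SL n\<close>; the rescaling in \<open>borel_closure_upper\<close> absorbs the sign.\<close>

definition swap_mat :: "nat \<Rightarrow> nat \<Rightarrow> complex mat" where
  "swap_mat n k = mat n n (\<lambda>(i, j). if simple_reflection k i = j then 1 else 0)"

definition swap_conj :: "nat \<Rightarrow> nat \<Rightarrow> complex mat \<Rightarrow> complex mat" where
  "swap_conj n k X = mat n n (\<lambda>(i, j). X $$ (simple_reflection k i, simple_reflection k j))"

lemma elementary_carrier [simp]:
  "lower_mat n k t \<in> carrier_mat n n" "lower_conj n k t X \<in> carrier_mat n n"
  "swap_mat n k \<in> carrier_mat n n" "swap_conj n k X \<in> carrier_mat n n"
  by (simp_all add: lower_mat_def lower_conj_def swap_mat_def swap_conj_def)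

lemma lower_mat_mult_left:
  assumes "X \<in> carrier_mat n m" "k + 1 < n" "i < n" "j < m"
  shows "(lower_mat n k t * X) $$ (i, j) = X $$ (i, j) + (if i = k + 1 then t * X $$ (k, j) else 0)"
proof -
  have "(lower_mat n k t * X) $$ (i, j) = (\<Sum>l<n. (if l = i then X $$ (l, j) else 0) +
      (if l = k then (if i = k + 1 then t * X $$ (l, j) else 0) else 0))"
    unfolding index_mult_mat_sum[OF elementary_carrier(1) assms(1,3,4)]
    using assms(3) by (intro sum.cong) (auto simp: lower_mat_def algebra_simps)
  then show ?thesis
    using assms by (simp add: sum.distrib)
qed

lemma lower_mat_mult_right:
  assumes "X \<in> carrier_mat m n" "k + 1 < n" "i < m" "j < n"
  shows "(X * lower_mat n k t) $$ (i, j) = X $$ (i, j) + (if j = k then t * X $$ (i, k + 1) else 0)"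
proof -
  have "(X * lower_mat n k t) $$ (i, j) = (\<Sum>l<n. (if l = j then X $$ (i, l) else 0) +
      (if l = k + 1 then (if j = k then t * X $$ (i, l) else 0) else 0))"
    unfolding index_mult_mat_sum[OF assms(1) elementary_carrier(1) assms(3,4)]
    using assms(4) by (intro sum.cong) (auto simp: lower_mat_def algebra_simps)
  then show ?thesis
    using assms by (simp add: sum.distrib)
qed

lemma swap_mat_mult_left:
  assumes "X \<in> carrier_mat n m" "k + 1 < n" "i < n" "j < m"
  shows "(swap_mat n k * X) $$ (i, j) = X $$ (simple_reflection k i, j)"
proof -
  have "(swap_mat n k * X) $$ (i, j) = (\<Sum>l<n. if l = simple_reflection k i then X $$ (l, j) else 0)"
    unfolding index_mult_mat_sum[OF elementary_carrier(3) assms(1,3,4)]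
    using assms(3) by (intro sum.cong) (auto simp: swap_mat_def)
  then show ?thesis
    using simple_reflection_less[OF assms(2,3)] by simp
qed

lemma swap_mat_mult_right:
  assumes "X \<in> carrier_mat m n" "k + 1 < n" "i < m" "j < n"
  shows "(X * swap_mat n k) $$ (i, j) = X $$ (i, simple_reflection k j)"
proof -
  have "(X * swap_mat n k) $$ (i, j) = (\<Sum>l<n. if l = simple_reflection k j then X $$ (i, l) else 0)"
    unfolding index_mult_mat_sum[OF assms(1) elementary_carrier(3) assms(3,4)]
    using assms(4) by (intro sum.cong) (auto simp: swap_mat_def)
  then show ?thesis
    using simple_reflection_less[OF assms(2,4)] by simp
qed

lemma lower_mat_inverse:
  assumes "k + 1 < n"
  shows "lower_mat n k t * lower_mat n k (- t) = 1\<^sub>m n"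
proof (rule eq_matI)
  fix i j assume "i < dim_row (1\<^sub>m n :: complex mat)" "j < dim_col (1\<^sub>m n :: complex mat)"
  then show "(lower_mat n k t * lower_mat n k (- t)) $$ (i, j) = 1\<^sub>m n $$ (i, j)"
    using assms by (simp only: lower_mat_mult_left[OF elementary_carrier(1)] index_one_mat)
      (auto simp: lower_mat_def)
qed (auto simp: lower_mat_def)

lemma swap_mat_inverse:
  assumes "k + 1 < n"
  shows "swap_mat n k * swap_mat n k = 1\<^sub>m n"
proof (rule eq_matI)
  fix i j assume "i < dim_row (1\<^sub>m n :: complex mat)" "j < dim_col (1\<^sub>m n :: complex mat)"
  then show "(swap_mat n k * swap_mat n k) $$ (i, j) = 1\<^sub>m n $$ (i, j)"
    using assms simple_reflection_less[of k n i]
    by (simp only: swap_mat_mult_left[OF elementary_carrier(3)] index_one_mat)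
      (auto simp: swap_mat_def)
qed (auto simp: swap_mat_def)

lemma similar_lower_conj:
  assumes X: "X \<in> carrier_mat n n" and k: "k + 1 < n"
  shows "similar_mat_wit (lower_conj n k t X) X (lower_mat n k t) (lower_mat n k (- t))"
proof (rule similar_mat_witI[where n = n])
  show "lower_mat n k t * lower_mat n k (- t) = 1\<^sub>m n" "lower_mat n k (- t) * lower_mat n k t = 1\<^sub>m n"
    using lower_mat_inverse[OF k, of t] lower_mat_inverse[OF k, of "- t"] by simp_all
  have C: "lower_mat n k t * X \<in> carrier_mat n n"
    by (rule mult_carrier_mat[OF elementary_carrier(1) X])
  show "lower_conj n k t X = lower_mat n k t * X * lower_mat n k (- t)"
  proof (rule eq_matI)
    fix i j assume "i < dim_row (lower_mat n k t * X * lower_mat n k (- t))"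
      "j < dim_col (lower_mat n k t * X * lower_mat n k (- t))"
    then have ij: "i < n" "j < n" by (auto simp: lower_mat_def)
    show "lower_conj n k t X $$ (i, j) = (lower_mat n k t * X * lower_mat n k (- t)) $$ (i, j)"
      unfolding lower_mat_mult_right[OF C k ij] using ij k
      by (simp only: lower_mat_mult_left[OF X k]) (auto simp: lower_conj_def algebra_simps)
  qed (auto simp: lower_conj_def lower_mat_def)
qed (use X in auto)

lemma similar_swap_conj:
  assumes X: "X \<in> carrier_mat n n" and k: "k + 1 < n"
  shows "similar_mat_wit (swap_conj n k X) X (swap_mat n k) (swap_mat n k)"
proof (rule similar_mat_witI[where n = n])
  show "swap_mat n k * swap_mat n k = 1\<^sub>m n" "swap_mat n k * swap_mat n k = 1\<^sub>m n"
    using swap_mat_inverse[OF k] by simp_all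
  have C: "swap_mat n k * X \<in> carrier_mat n n"
    by (rule mult_carrier_mat[OF elementary_carrier(3) X])
  show "swap_conj n k X = swap_mat n k * X * swap_mat n k"
  proof (rule eq_matI)
    fix i j assume "i < dim_row (swap_mat n k * X * swap_mat n k)"
      "j < dim_col (swap_mat n k * X * swap_mat n k)"
    then have ij: "i < n" "j < n" by (auto simp: swap_mat_def)
    show "swap_conj n k X $$ (i, j) = (swap_mat n k * X * swap_mat n k) $$ (i, j)"
      unfolding swap_mat_mult_right[OF C k ij] using ij simple_reflection_less[OF k]
      by (simp only: swap_mat_mult_left[OF X k]) (auto simp: swap_conj_def)
  qed (auto simp: swap_conj_def swap_mat_def)
qed (use X in auto)

lemma swap_conj_involution:
  assumes X: "X \<in> carrier_mat n n" and k: "k + 1 < n"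
  shows "swap_conj n k (swap_conj n k X) = X"
  using X simple_reflection_less[OF k] by (intro eq_matI) (auto simp: swap_conj_def)

lemma lower_conj_inverse:
  assumes X: "X \<in> carrier_mat n n" and k: "k + 1 < n"
  shows "lower_conj n k (- t) (lower_conj n k t X) = X"
  using X k by (intro eq_matI) (auto simp: lower_conj_def algebra_simps)

lemma lower_conj_0:
  assumes "X \<in> carrier_mat n n"
  shows "lower_conj n k 0 X = X"
  using assms by (intro eq_matI) (auto simp: lower_conj_def)

text \<open>Serves for a constant parameter, for the parameter of a curve, and for the rational
  parameter \<open>clearing\<close>.\<close>

lemma (in function_algebra) matrices_lower_conj:
  assumes t: "t \<in> F" and M: "M \<in> matrices n n" and k: "k + 1 < n"
  shows "(\<lambda>x. lower_conj n k (t x) (M x)) \<in> matrices n n"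
proof (rule matricesI)
  fix i j assume ij: "i < n" "j < n"
  have if_mem: "(\<lambda>x. if P then f x else 0) \<in> F" if "P \<Longrightarrow> f \<in> F" for f P
    using that const_mem[of 0] by (cases P) auto
  have e: "(\<lambda>x. M x $$ (i', j')) \<in> F" if "i' < n" "j' < n" for i' j'
    by (rule matrices_entry[OF M that])
  have "(\<lambda>x. M x $$ (i, j) + (if i = k + 1 then t x * M x $$ (k, j) else 0) -
     (if j = k then t x * (M x $$ (i, k + 1) + (if i = k + 1 then t x * M x $$ (k, k + 1) else 0)) else 0)) \<in> F"
    by (rule diff_mem add_mem if_mem mult_mem t e | use ij k in simp)+
  then show "(\<lambda>x. lower_conj n k (t x) (M x) $$ (i, j)) \<in> F"
    using ij by (simp add: lower_conj_def)
qed simp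

text \<open>Membership in the parabolic subgroup \<open>P\<^sub>k\<close>, without the determinant condition.\<close>

definition almost_upper :: "nat \<Rightarrow> 'a :: zero mat \<Rightarrow> bool" where
  "almost_upper k p \<longleftrightarrow> (\<forall>i<dim_row p. \<forall>j<i. (i, j) \<noteq> (k + 1, k) \<longrightarrow> p $$ (i, j) = 0)"

lemma almost_upper_upper: "upper_triangular p \<Longrightarrow> almost_upper k p"
  by (auto simp: almost_upper_def)

lemma almost_upperD:
  "almost_upper k p \<Longrightarrow> i < dim_row p \<Longrightarrow> j < i \<Longrightarrow> (i, j) \<noteq> (k + 1, k) \<Longrightarrow> p $$ (i, j) = 0"
  by (auto simp: almost_upper_def)

lemma upper_triangular_almost_upper:
  assumes p: "almost_upper k p" and "k + 1 < dim_row p \<Longrightarrow> p $$ (k + 1, k) = 0"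
  shows "upper_triangular p"
proof (rule upper_triangularI)
  fix i j assume "j < i" "i < dim_row p"
  then show "p $$ (i, j) = 0" using almost_upperD[OF p, of i j] assms(2) by auto
qed

text \<open>A nonzero summand steps from \<open>i\<close> to \<open>m\<close> to \<open>j\<close>,
  where each step is weakly increasing or leads from \<open>k + 1\<close> to \<open>k\<close>. The
  exceptional step cannot occur twice in a row, so the only possible descent is again from
  \<open>k + 1\<close> to \<open>k\<close>.\<close>

lemma almost_upper_mult:
  assumes p: "p \<in> carrier_mat n n" "almost_upper k p" and q: "q \<in> carrier_mat n n" "almost_upper k q"
  shows "almost_upper k (p * (q :: 'a :: semiring_0 mat))"
  unfolding almost_upper_def
proof (intro allI impI)
  fix i j assume "i < dim_row (p * q)" and ij: "j < i" "(i, j) \<noteq> (k + 1, k)"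
  then have i: "i < n" using p by simp
  have "p $$ (i, m) * q $$ (m, j) = 0" if m: "m < n" for m
  proof (cases "m < i \<and> (i, m) \<noteq> (k + 1, k)")
    case True
    then show ?thesis using almost_upperD[OF p(2)] p(1) i by simp
  next
    case False
    then have *: "i \<le> m \<or> i = k + 1 \<and> m = k" by auto
    then have "j < m" using ij by (cases "i \<le> m") (simp_all add: less_Suc_eq)
    moreover have "\<not> (m = k + 1 \<and> j = k)" using * ij by auto
    ultimately have "j < m" "(m, j) \<noteq> (k + 1, k)" by simp_all
    then show ?thesis using almost_upperD[OF q(2), of m j] q(1) m by simp
  qed
  then show "(p * q) $$ (i, j) = 0"
    using index_mult_mat_sum[OF p(1) q(1) i, of j] i ij by simp
qed

lemma almost_upper_lower_mat: "almost_upper k (lower_mat n k t)"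
  by (auto simp: almost_upper_def lower_mat_def)

lemma almost_upper_swap_mat: "almost_upper k (swap_mat n k)"
  by (auto simp: almost_upper_def swap_mat_def simple_reflection_apply)

section \<open>Conjugation by upper triangular matrices\<close>

lemma upper_triangular_invertible_diag:
  assumes g: "g \<in> carrier_mat n n" "upper_triangular g" "h \<in> carrier_mat n n" "g * h = 1\<^sub>m n" and "i < n"
  shows "g $$ (i, i) \<noteq> (0 :: complex)"
proof -
  have "det g * det h = 1" using det_mult[OF g(1,3)] g(4) by simp
  then have "prod_list (diag_mat g) \<noteq> 0"
    using det_upper_triangular[OF g(2,1)] by (metis mult_zero_left zero_neq_one)
  moreover have "g $$ (i, i) \<in> set (diag_mat g)"
    using g(1) \<open>i < n\<close> by (auto simp: diag_mat_def)
  ultimately show ?thesis using prod_list_zero_iff by metis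
qed

text \<open>In \<open>A * g = g * X\<close> the nonzero diagonal entries of \<open>g\<close> can be
  cancelled column by column. The second claim shows that a simple root coordinate is only scaled by
  a nonzero factor.\<close>

lemma strictly_upper_conj:
  assumes wit: "similar_mat_wit A X g h" and g: "upper_triangular g" and X: "X \<in> strictly_upper n"
  shows "A \<in> strictly_upper n"
    and "k + 1 < n \<Longrightarrow> A $$ (k, k + 1) * g $$ (k + 1, k + 1) = g $$ (k, k) * X $$ (k, k + 1)"
proof -
  have A: "A \<in> carrier_mat n n"
    by (rule similar_mat_wit_carrier[OF wit strictly_upper_carrier[OF X]])
  note w = similar_mat_witD2[OF A wit]
  have Ag: "A * g = g * X"
    unfolding w(3) using w assoc_mult_mat[of "g * X" n n h n g n] by simp
  have left: "(A * g) $$ (i, j) = A $$ (i, j) * g $$ (j, j)"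
    if "i < n" "j < n" "\<And>m. m < j \<Longrightarrow> A $$ (i, m) = 0" for i j
  proof -
    have "(A * g) $$ (i, j) = (\<Sum>m<n. if m = j then A $$ (i, m) * g $$ (m, j) else 0)"
      unfolding index_mult_mat_sum[OF w(4,6) that(1,2)]
    proof (intro sum.cong refl)
      fix m assume "m \<in> {..<n}"
      then show "A $$ (i, m) * g $$ (m, j) = (if m = j then A $$ (i, m) * g $$ (m, j) else 0)"
        using that(3)[of m] upper_triangularD[OF g, of j m] w(6) by (cases m j rule: linorder_cases) auto
    qed
    then show ?thesis using that by simp
  qed
  have right: "(g * X) $$ (i, j) = (if j = i + 1 then g $$ (i, i) * X $$ (i, j) else 0)"
    if "i < n" "j < n" "j \<le> i + 1" for i j
  proof -
    have "(g * X) $$ (i, j) = (\<Sum>m<n. if m = i then g $$ (i, m) * X $$ (m, j) else 0)"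
      unfolding index_mult_mat_sum[OF w(6,5) that(1,2)]
    proof (intro sum.cong refl)
      fix m assume "m \<in> {..<n}"
      then show "g $$ (i, m) * X $$ (m, j) = (if m = i then g $$ (i, m) * X $$ (m, j) else 0)"
        using strictly_upper_zero[OF X, of m j] upper_triangularD[OF g, of m i] w(6) that
        by (cases m i rule: linorder_cases) auto
    qed
    then show ?thesis using that strictly_upper_zero[OF X, of i j] by simp
  qed
  have zero: "A $$ (i, j) = 0" if "j \<le> i" "i < n" for i j
    using that
  proof (induction j rule: less_induct)
    case (less j)
    then have "A $$ (i, j) * g $$ (j, j) = 0"
      using left[of i j] right[of i j] Ag by simp
    then show ?case
      using upper_triangular_invertible_diag[OF w(6) g w(7,1)] less.prems by simp
  qed
  then show "A \<in> strictly_upper n"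
    using A unfolding strictly_upper_def by (auto simp: not_less[symmetric])
  show "A $$ (k, k + 1) * g $$ (k + 1, k + 1) = g $$ (k, k) * X $$ (k, k + 1)" if "k + 1 < n"
    using left[of k "k + 1"] right[of k "k + 1"] zero[of _ k] that Ag by simp
qed

text \<open>Scaling the conjugating matrix to determinant 1 puts it into
  \<open>Borel n\<close>.\<close>

lemma borel_closure_upper:
  assumes X: "X \<in> borel_closure n w" and wit: "similar_mat_wit A X g h" and g: "upper_triangular g"
  shows "A \<in> borel_closure n w"
proof -
  have "X \<in> carrier_mat n n" using X borel_closure_sl sl_carrier by blast
  then have A: "A \<in> carrier_mat n n" by (rule similar_mat_wit_carrier[OF wit])
  then obtain c where c: "c \<cdot>\<^sub>m g \<in> SL n" "similar_mat_wit A X (c \<cdot>\<^sub>m g) (inverse c \<cdot>\<^sub>m h)"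
    using similar_mat_wit_SL[OF wit] by metis
  have "upper_triangular (c \<cdot>\<^sub>m g)"
    using upper_triangularD[OF g] similar_mat_witD2(6)[OF A wit] by (intro upper_triangularI) auto
  then have "c \<cdot>\<^sub>m g \<in> Borel n"
    using c(1) by (simp add: Borel_def)
  then show ?thesis
    using saturationI[OF X _ c(2)] saturation_borel_closure by blast
qed

section \<open>Stability under minimal parabolic subgroups\<close>

lemma n_cap_conj_lower_conj:
  assumes X: "X \<in> n_cap_conj n w" and k: "k \<in> tau n w"
  shows "lower_conj n k t X \<in> n_cap_conj n w"
proof -
  have k1: "k + 1 < n" and inv: "Hilbert_Choice.inv w (k + 1) < Hilbert_Choice.inv w k"
    using k by (auto simp: tau_def simple_roots_def)
  have R: "i < j" "Hilbert_Choice.inv w i < Hilbert_Choice.inv w j"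
    if "X $$ (i, j) \<noteq> 0" "i < n" "j < n" for i j
    using X that unfolding n_cap_conj_iff by blast+
  have Xk: "X $$ (k, k + 1) = 0" using R(2)[of k "k + 1"] k1 inv by auto
  \<comment> \<open>The row and column operations only fill positions that the inequality
    \<open>inv\<close> allows anyway. The zero entry at \<open>(k, k + 1)\<close> keeps the result
    strictly upper triangular.\<close>
  have "i < j \<and> Hilbert_Choice.inv w i < Hilbert_Choice.inv w j"
    if ij: "i < n" "j < n" and nz: "lower_conj n k t X $$ (i, j) \<noteq> 0" for i j
  proof -
    have "X $$ (i, j) \<noteq> 0 \<or> i = k + 1 \<and> X $$ (k, j) \<noteq> 0 \<or> j = k \<and> X $$ (i, k + 1) \<noteq> 0"
    proof (rule ccontr)
      assume "\<not> ?thesis"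
      then show False using nz ij Xk by (auto simp: lower_conj_def split: if_splits)
    qed
    then consider "X $$ (i, j) \<noteq> 0" | "i = k + 1" "X $$ (k, j) \<noteq> 0" | "j = k" "X $$ (i, k + 1) \<noteq> 0"
      by blast
    then show ?thesis
    proof cases
      case 1
      then show ?thesis using R ij by blast
    next
      case 2
      then have "j \<noteq> k + 1" "k < j" using R(1)[of k j] Xk k1 ij by auto
      then show ?thesis using 2 R(2)[of k j] inv k1 ij by auto
    next
      case 3
      then have "i \<noteq> k" "i < k + 1" using R(1)[of i "k + 1"] Xk k1 ij by auto
      then show ?thesis using 3 R(2)[of i "k + 1"] inv k1 ij by auto
    qed
  qed
  then show ?thesis unfolding n_cap_conj_iff by simp
qed

lemma inv_simple_reflection_comp:
  assumes "bij w"
  shows "Hilbert_Choice.inv (simple_reflection k \<circ> w) i = Hilbert_Choice.inv w (simple_reflection k i)"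
proof (rule inv_f_eq)
  show "inj (simple_reflection k \<circ> w)"
    using bij_is_inj[OF assms] by (simp add: simple_reflection_def inj_compose)
  show "(simple_reflection k \<circ> w) (Hilbert_Choice.inv w (simple_reflection k i)) = i"
    using surj_f_inv_f[OF bij_is_surj[OF assms]] by simp
qed

text \<open>The reflection permutes the positive roots other than its own, and the coordinate at
  that root is zero.\<close>

lemma n_cap_conj_swap_conj:
  assumes X: "X \<in> n_cap_conj n w" and Xk: "X $$ (k, k + 1) = 0" and k: "k + 1 < n" and w: "bij w"
  shows "swap_conj n k X \<in> n_cap_conj n (simple_reflection k \<circ> w)"
proof -
  let ?s = "simple_reflection k"
  have "i < j \<and> Hilbert_Choice.inv w (?s i) < Hilbert_Choice.inv w (?s j)"
    if ij: "i < n" "j < n" and nz: "swap_conj n k X $$ (i, j) \<noteq> 0" for i j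
  proof -
    have nz: "X $$ (?s i, ?s j) \<noteq> 0" using nz ij by (simp add: swap_conj_def)
    then have "?s i < ?s j" and inv: "Hilbert_Choice.inv w (?s i) < Hilbert_Choice.inv w (?s j)"
      using X simple_reflection_less[OF k] ij unfolding n_cap_conj_iff by blast+
    moreover have "(?s i, ?s j) \<noteq> (k, k + 1)" using nz Xk by auto
    ultimately show ?thesis using simple_reflection_less_iff[of k i j] by blast
  qed
  then show ?thesis unfolding n_cap_conj_iff inv_simple_reflection_comp[OF w] by simp
qed

text \<open>If \<open>k\<close> lies in the \<open>\<tau>\<close>-invariant, then \<open>\<nn> \<inter> \<^sup>w\<nn>\<close> is stable under the root subgroup of
  \<open>-\<alpha>\<^sub>k\<close>. The big cell \<open>B U\<^sub>-\<close> of \<open>P\<^sub>k\<close> being dense, the Borel closure is then stable under \<open>P\<^sub>k\<close>.\<close>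

lemma borel_closure_lower_conj:
  assumes X: "X \<in> borel_closure n w" and k: "k \<in> tau n w"
  shows "lower_conj n k t X \<in> borel_closure n w"
proof -
  have k1: "k + 1 < n" using k by (simp add: tau_def simple_roots_def)
  let ?S = "saturation (Borel n) (n_cap_conj n w)" and ?zc = "zariski_closure n"
  have sl: "lower_conj n k t Y \<in> sl n" if "Y \<in> sl n" for Y t
    using similar_mat_wit_sl[OF similar_lower_conj[OF sl_carrier[OF that] k1] that] .
  have S: "lower_conj n k t Y \<in> ?zc ?S" if Y: "Y \<in> ?S" for Y t
  proof -
    obtain N b h where N: "N \<in> n_cap_conj n w" and b: "b \<in> Borel n" and wit: "similar_mat_wit Y N b h"
      using Y by (auto simp: saturation_def)
    have Ysl: "Y \<in> sl n" using Y saturation_sl[OF n_cap_conj_sl] by blast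
    note YC = sl_carrier[OF Ysl]
    note w = similar_mat_witD2[OF YC wit]
    have bu: "upper_triangular b" using b by (simp add: Borel_def)
    \<comment> \<open>\<open>lower_mat n k u * b\<close> lies in the big cell unless
      \<open>b $$ (k + 1, k + 1) + u * b $$ (k, k + 1)\<close> vanishes. As the first term is
      nonzero, at most one \<open>u\<close> is excluded.\<close>
    have "b $$ (k + 1, k + 1) \<noteq> 0"
      using upper_triangular_invertible_diag[OF w(6) bu w(7,1) k1] .
    then have "t = - b $$ (k + 1, k + 1) / b $$ (k, k + 1)"
      if "b $$ (k + 1, k + 1) + t * b $$ (k, k + 1) = 0" for t
    proof -
      have "b $$ (k, k + 1) \<noteq> 0" using that \<open>b $$ (k + 1, k + 1) \<noteq> 0\<close> by auto
      moreover have "t * b $$ (k, k + 1) = - b $$ (k + 1, k + 1)"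
        using that by (simp add: add_eq_0_iff)
      ultimately show ?thesis by (metis nonzero_mult_div_cancel_right)
    qed
    then have "{t. b $$ (k + 1, k + 1) + t * b $$ (k, k + 1) = 0} \<subseteq> {- b $$ (k + 1, k + 1) / b $$ (k, k + 1)}"
      by blast
    then have fin: "finite {t. b $$ (k + 1, k + 1) + t * b $$ (k, k + 1) = 0}"
      by (rule finite_subset) simp
    have mem: "(\<lambda>t. lower_conj n k t Y) \<in> univariate.matrices n n"
      by (rule univariate.matrices_lower_conj[OF univariate_id univariate.matrices_const[OF YC] k1])
    have "lower_conj n k u Y \<in> ?S" if u: "b $$ (k + 1, k + 1) + u * b $$ (k, k + 1) \<noteq> 0" for u
    proof -
      \<comment> \<open>This \<open>v\<close> makes the entry of \<open>p\<close> at
        \<open>(k + 1, k)\<close> vanish, so that \<open>lower_mat n k u * b\<close> factors as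
        \<open>p * lower_mat n k v\<close> with \<open>p\<close> upper triangular.\<close>
      define v where "v = u * b $$ (k, k) / (b $$ (k + 1, k + 1) + u * b $$ (k, k + 1))"
      define p where "p = lower_mat n k u * b * lower_mat n k (- v)"
      have Lb: "lower_mat n k u * b \<in> carrier_mat n n"
        by (rule mult_carrier_mat[OF elementary_carrier(1) w(6)])
      have pC: "p \<in> carrier_mat n n"
        unfolding p_def by (rule mult_carrier_mat[OF Lb elementary_carrier(1)])
      have "similar_mat_wit (lower_conj n k u Y) N (lower_mat n k u * b) (h * lower_mat n k (- u))"
        by (rule similar_mat_wit_trans[OF similar_lower_conj[OF YC k1] wit])
      from similar_mat_wit_trans[OF this similar_mat_wit_sym[OF similar_lower_conj[OF w(5) k1]], of v]
      have wit': "similar_mat_wit (lower_conj n k u Y) (lower_conj n k v N) p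
          (lower_mat n k v * (h * lower_mat n k (- u)))"
        unfolding p_def .
      have "almost_upper k p"
        unfolding p_def using w bu Lb
        by (intro almost_upper_mult almost_upper_lower_mat almost_upper_upper) auto
      moreover have "p $$ (k + 1, k) = 0"
      proof -
        have "p $$ (k + 1, k) = (lower_mat n k u * b) $$ (k + 1, k) - v * (lower_mat n k u * b) $$ (k + 1, k + 1)"
          unfolding p_def using k1 by (subst lower_mat_mult_right[OF Lb k1]) auto
        also have "\<dots> = u * b $$ (k, k) - v * (b $$ (k + 1, k + 1) + u * b $$ (k, k + 1))"
          using k1 bu w(6) by (simp only: lower_mat_mult_left[OF w(6) k1]) auto
        also have "\<dots> = 0" using u by (simp add: v_def)
        finally show ?thesis .
      qed
      ultimately have pu: "upper_triangular p" by (intro upper_triangular_almost_upper)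
      have "det (lower_mat n k t) = 1" for t
      proof -
        have "det (transpose_mat (lower_mat n k t)) = prod_list (diag_mat (transpose_mat (lower_mat n k t)))"
          by (rule det_upper_triangular[where n = n]) (auto simp: lower_mat_def upper_triangular_def)
        also have "diag_mat (transpose_mat (lower_mat n k t)) = map (\<lambda>i. 1) [0..<n]"
          by (auto simp: diag_mat_def lower_mat_def)
        finally show ?thesis
          using det_transpose[OF elementary_carrier(1)] by (simp add: map_replicate_const)
      qed
      then have "det p = 1"
        using det_mult[OF Lb elementary_carrier(1)] det_mult[OF elementary_carrier(1) w(6)] b
        by (simp add: p_def Borel_def SL_def)
      then have "p \<in> Borel n" using pC pu by (simp add: Borel_def SL_def)
      then show ?thesis
        using saturationI[OF n_cap_conj_lower_conj[OF N k] _ wit'] by blast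
    qed
    note cell = this
    show ?thesis
    proof (rule zariski_closure_curve[OF mem sl[OF Ysl] fin])
      fix u assume "u \<notin> {t. b $$ (k + 1, k + 1) + t * b $$ (k, k + 1) = 0}"
      then show "lower_conj n k u Y \<in> ?zc ?S"
        by (intro subsetD[OF zariski_closure_incl[OF saturation_sl[OF n_cap_conj_sl]]] cell) simp
    qed
  qed
  have tm: "(\<lambda>Z. lower_conj n k t (trunc n Z)) \<in> polynomial_functions.matrices n n n"
    by (rule polynomial_functions.matrices_lower_conj[OF polynomial_functions.const_mem trunc_mem k1])
  have Xsl: "X \<in> sl n" using X borel_closure_sl by blast
  have tr: "trunc n Z = Z" if "Z \<in> sl n" for Z using sl_carrier[OF that] by simp
  have "lower_conj n k t (trunc n X) \<in> ?zc ?S"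
  proof (rule zariski_closure_image[OF X[unfolded borel_closure_def] tm])
    show "lower_conj n k t (trunc n X) \<in> sl n" using sl[OF Xsl] tr[OF Xsl] by simp
    fix Y assume Y: "Y \<in> ?S"
    then have "Y \<in> sl n" using saturation_sl[OF n_cap_conj_sl] by blast
    then show "lower_conj n k t (trunc n Y) \<in> ?zc ?S" using S[OF Y] tr by simp
  qed
  then show ?thesis using tr[OF Xsl] by (simp add: borel_closure_def)
qed

text \<open>Conjugating the swap matrix by \<open>lower_mat n k 1\<close> gives an upper triangular
  \<open>p\<close>. The swap is thus a product of matrices whose conjugations all preserve the
  closure.\<close>

lemma borel_closure_swap_conj:
  assumes X: "X \<in> borel_closure n w" and k: "k \<in> tau n w"
  shows "swap_conj n k X \<in> borel_closure n w"
proof -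
  have k1: "k + 1 < n" using k by (simp add: tau_def simple_roots_def)
  have XC: "X \<in> carrier_mat n n" using X borel_closure_sl sl_carrier by blast
  define p where "p = lower_mat n k 1 * swap_mat n k * lower_mat n k (- 1)"
  define Y where "Y = lower_conj n k 1 (swap_conj n k X)"
  have LS: "lower_mat n k 1 * swap_mat n k \<in> carrier_mat n n" 
    by (rule mult_carrier_mat[OF elementary_carrier(1,3)])
  have "similar_mat_wit Y X (lower_mat n k 1 * swap_mat n k) (swap_mat n k * lower_mat n k (- 1))"
    unfolding Y_def
    by (rule similar_mat_wit_trans[OF similar_lower_conj[OF elementary_carrier(4) k1] similar_swap_conj[OF XC k1]])
  from similar_mat_wit_trans[OF this similar_mat_wit_sym[OF similar_lower_conj[OF XC k1]], of 1]
  have wit: "similar_mat_wit Y (lower_conj n k 1 X) p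
      (lower_mat n k 1 * (swap_mat n k * lower_mat n k (- 1)))"
    unfolding p_def .
  have "almost_upper k p"
    unfolding p_def
    by (intro almost_upper_mult[where n = n] almost_upper_lower_mat almost_upper_swap_mat LS)
      simp_all
  moreover have "p $$ (k + 1, k) = 0"
  proof -
    have "(lower_mat n k 1 * swap_mat n k) $$ (k + 1, j) = 1" if "j = k \<or> j = k + 1" for j
      using that k1 lower_mat_mult_left[OF elementary_carrier(3)[of n k] k1, of "k + 1" j 1]
      by (auto simp: swap_mat_def simple_reflection_apply simp del: index_mult_mat(1))
    then show ?thesis
      unfolding p_def using k1 lower_mat_mult_right[OF LS k1, of "k + 1" k "- 1"]
      by (simp del: index_mult_mat(1))
  qed
  ultimately have "upper_triangular p" by (intro upper_triangular_almost_upper)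
  then have "Y \<in> borel_closure n w"
    by (rule borel_closure_upper[OF borel_closure_lower_conj[OF X k] wit])
  then have "lower_conj n k (- 1) Y \<in> borel_closure n w" by (rule borel_closure_lower_conj[OF _ k])
  then show ?thesis using lower_conj_inverse[OF elementary_carrier(4) k1] by (simp add: Y_def)
qed

section \<open>Transfer along a pair of adjacent roots\<close>

text \<open>The localization at \<open>d\<close>, with functions compared only where
  \<open>d\<close> is nonzero; sums and products are brought to a common power of
  \<open>d\<close>.\<close>

lemma function_algebra_localization:
  assumes d: "d \<in> polynomial_functions n"
  shows "function_algebra {g. \<exists>N. \<exists>f\<in>polynomial_functions n. \<forall>X. d X \<noteq> 0 \<longrightarrow> f X = d X ^ N * g X}"
    (is "function_algebra ?F")
proof
  fix c
  show "(\<lambda>_. c) \<in> ?F"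
    using polynomial_functions.const_mem[where c = c] by (auto intro!: exI[of _ 0] bexI[of _ "\<lambda>_. c"])
next
  fix g g' assume "g \<in> ?F" "g' \<in> ?F"
  then obtain N f N' f' where f: "f \<in> polynomial_functions n" "\<And>X. d X \<noteq> 0 \<Longrightarrow> f X = d X ^ N * g X"
    and f': "f' \<in> polynomial_functions n" "\<And>X. d X \<noteq> 0 \<Longrightarrow> f' X = d X ^ N' * g' X"
    by auto
  have "(\<lambda>X. d X ^ N' * f X + d X ^ N * f' X) \<in> polynomial_functions n"
    by (intro polynomial_functions.add_mem polynomial_functions.mult_mem polynomial_functions.power_mem d f f')
  then show "(\<lambda>X. g X + g' X) \<in> ?F"
    using f(2) f'(2)
    by (auto intro!: exI[of _ "N + N'"] bexI[of _ "\<lambda>X. d X ^ N' * f X + d X ^ N * f' X"]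
        simp: power_add algebra_simps)
  have "(\<lambda>X. f X * f' X) \<in> polynomial_functions n"
    by (intro polynomial_functions.mult_mem f f')
  then show "(\<lambda>X. g X * g' X) \<in> ?F"
    using f(2) f'(2)
    by (auto intro!: exI[of _ "N + N'"] bexI[of _ "\<lambda>X. f X * f' X"] simp: power_add)
qed

section \<open>Coordinates at two adjacent roots and the retraction\<close>

definition root_entry :: "nat \<Rightarrow> complex mat \<Rightarrow> complex" where
  "root_entry k X = X $$ (k, k + 1)"

text \<open>The coordinate of the root \<open>\<alpha> + \<beta>\<close>.\<close>

definition sum_entry :: "nat \<Rightarrow> nat \<Rightarrow> complex mat \<Rightarrow> complex" where
  "sum_entry \<alpha> \<beta> X = X $$ (min \<alpha> \<beta>, min \<alpha> \<beta> + 2)"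

text \<open>The parameter for which \<open>lower_conj n \<beta>\<close> kills the coordinate of \<open>\<alpha>\<close>.\<close>

definition clearing :: "nat \<Rightarrow> nat \<Rightarrow> complex mat \<Rightarrow> complex" where
  "clearing \<alpha> \<beta> X = (if \<alpha> < \<beta> then 1 else - 1) * root_entry \<alpha> X * inverse (sum_entry \<alpha> \<beta> X)"

lemma sum_entry_commute: "sum_entry \<alpha> \<beta> = sum_entry \<beta> \<alpha>"
  by (simp add: sum_entry_def[abs_def] min.commute)

lemma adjacent_cases:
  assumes "adjacent_roots \<alpha> \<beta>"
  obtains "\<beta> = \<alpha> + 1" | "\<alpha> = \<beta> + 1"
  using assms unfolding adjacent_roots_def by (auto simp: doubleton_eq_iff)

locale adjacent_pair =
  fixes n \<alpha> \<beta> :: nat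
  assumes \<alpha>: "\<alpha> + 1 < n" and \<beta>: "\<beta> + 1 < n" and adj: "adjacent_roots \<alpha> \<beta>"
begin

lemma min_less: "min \<alpha> \<beta> + 2 < n"
  using adj \<alpha> \<beta> by (cases rule: adjacent_cases) simp_all

text \<open>The reflection at \<beta> interchanges the roots \<alpha> and \<alpha> +
  \<beta>.\<close>

lemma root_entry_swap_conj:
  "root_entry \<alpha> (swap_conj n \<beta> X) = sum_entry \<alpha> \<beta> X"
  "sum_entry \<alpha> \<beta> (swap_conj n \<beta> X) = root_entry \<alpha> X"
  using adj \<alpha> \<beta>
  by (cases rule: adjacent_cases;
      simp add: root_entry_def sum_entry_def swap_conj_def simple_reflection_apply)+

text \<open>A multiple of the \<alpha> + \<beta> coordinate is subtracted from the \<alpha>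
  coordinate by the column operation if \<alpha> < \<beta>, and added to it by the row operation
  otherwise. This explains the sign in \<open>clearing\<close>.\<close>

lemma lower_conj_clearing:
  shows "sum_entry \<alpha> \<beta> (lower_conj n \<beta> t X) = sum_entry \<alpha> \<beta> X"
    and "sum_entry \<alpha> \<beta> X \<noteq> 0 \<Longrightarrow> root_entry \<alpha> (lower_conj n \<beta> (clearing \<alpha> \<beta> X) X) = 0"
  using adj \<alpha> \<beta>
  by (cases rule: adjacent_cases;
      simp add: root_entry_def sum_entry_def lower_conj_def clearing_def)+

lemma sum_entry_polynomial: "sum_entry \<alpha> \<beta> \<in> polynomial_functions n"
  unfolding sum_entry_def[abs_def] using min_less by (intro polynomial_functions.entry) auto

lemma root_entry_polynomial: "root_entry \<alpha> \<in> polynomial_functions n" "root_entry \<beta> \<in> polynomial_functions n"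
  unfolding root_entry_def[abs_def] using \<alpha> \<beta> by (auto intro: polynomial_functions.entry)

text \<open>Compare the entries of \<open>W p = p X\<close> in the row \<open>\<alpha>\<close>, column \<open>\<beta>\<close> if \<open>\<alpha> < \<beta>\<close>, and in the
  row \<open>\<alpha>\<close>, column \<open>\<alpha> + 1\<close> otherwise.\<close>

lemma conj_upper_triangular:
  assumes wit: "similar_mat_wit W X p q" and p: "almost_upper \<beta> p"
    and W: "W \<in> strictly_upper n" "root_entry \<alpha> W = 0" "sum_entry \<alpha> \<beta> W \<noteq> 0"
    and X: "X \<in> strictly_upper n" "root_entry \<alpha> X = 0" "sum_entry \<alpha> \<beta> X \<noteq> 0"
  shows "upper_triangular p"
proof -
  note w = similar_mat_witD2[OF strictly_upper_carrier[OF W(1)] wit]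
  have Wp: "W * p = p * X"
    unfolding w(3) using w assoc_mult_mat[of "p * X" n n q n p n] by simp
  have "p $$ (\<beta> + 1, \<beta>) = 0"
    using adj
  proof (cases rule: adjacent_cases)
    case 1
    then have "sum_entry \<alpha> \<beta> W = W $$ (\<alpha>, \<beta> + 1)" by (simp add: sum_entry_def)
    have "(W * p) $$ (\<alpha>, \<beta>) = (\<Sum>m<n. if m = \<beta> + 1 then W $$ (\<alpha>, m) * p $$ (m, \<beta>) else 0)"
      unfolding index_mult_mat_sum[OF w(4,6) order_less_trans[OF less_add_one \<alpha>] order_less_trans[OF less_add_one \<beta>]]
    proof (intro sum.cong refl)
      fix m assume "m \<in> {..<n}"
      then show "W $$ (\<alpha>, m) * p $$ (m, \<beta>) = (if m = \<beta> + 1 then W $$ (\<alpha>, m) * p $$ (m, \<beta>) else 0)"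
        using strictly_upper_zero[OF W(1), of \<alpha> m] W(2) almost_upperD[OF p, of m \<beta>] w(6) 1 \<alpha>
        by (cases "m \<le> \<alpha>"; cases "m = \<beta>"; auto simp: root_entry_def)
    qed
    moreover have "(p * X) $$ (\<alpha>, \<beta>) = 0"
      unfolding index_mult_mat_sum[OF w(6,5) order_less_trans[OF less_add_one \<alpha>] order_less_trans[OF less_add_one \<beta>]]
    proof (intro sum.neutral ballI)
      fix m assume "m \<in> {..<n}"
      then show "p $$ (\<alpha>, m) * X $$ (m, \<beta>) = 0"
        using strictly_upper_zero[OF X(1), of m \<beta>] X(2) almost_upperD[OF p, of \<alpha> m] w(6) 1 \<alpha>
        by (cases m \<alpha> rule: linorder_cases; auto simp: root_entry_def)
    qed
    ultimately have "W $$ (\<alpha>, \<beta> + 1) * p $$ (\<beta> + 1, \<beta>) = 0" using Wp \<beta> by simp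
    then show ?thesis using W(3) 1 by (simp add: sum_entry_def)
  next
    case 2
    have "(p * X) $$ (\<alpha>, \<alpha> + 1) = (\<Sum>m<n. if m = \<beta> then p $$ (\<alpha>, m) * X $$ (m, \<alpha> + 1) else 0)"
      unfolding index_mult_mat_sum[OF w(6,5) order_less_trans[OF less_add_one \<alpha>] \<alpha>]
    proof (intro sum.cong refl)
      fix m assume "m \<in> {..<n}"
      then show "p $$ (\<alpha>, m) * X $$ (m, \<alpha> + 1) = (if m = \<beta> then p $$ (\<alpha>, m) * X $$ (m, \<alpha> + 1) else 0)"
        using strictly_upper_zero[OF X(1), of m "\<alpha> + 1"] X(2) almost_upperD[OF p, of \<alpha> m] w(6) 2 \<alpha>
        by (cases m \<alpha> rule: linorder_cases; auto simp: root_entry_def)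
    qed
    moreover have "(W * p) $$ (\<alpha>, \<alpha> + 1) = 0"
      unfolding index_mult_mat_sum[OF w(4,6) order_less_trans[OF less_add_one \<alpha>] \<alpha>]
    proof (intro sum.neutral ballI)
      fix m assume "m \<in> {..<n}"
      then show "W $$ (\<alpha>, m) * p $$ (m, \<alpha> + 1) = 0"
        using strictly_upper_zero[OF W(1), of \<alpha> m] W(2) almost_upperD[OF p, of m "\<alpha> + 1"] w(6) 2 \<alpha>
        by (cases m "\<alpha> + 1" rule: linorder_cases; auto simp: root_entry_def)
    qed
    ultimately have "p $$ (\<beta> + 1, \<beta>) * X $$ (\<beta>, \<alpha> + 1) = 0" using Wp \<beta> 2 by simp
    then show ?thesis using X(3) 2 by (simp add: sum_entry_def)
  qed
  then show ?thesis using upper_triangular_almost_upper[OF p] by blast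
qed

text \<open>Only the coordinate at \<beta> could be moved out of the strictly upper triangular
  matrices.\<close>

lemma strictly_upper_lower_conj:
  assumes "X \<in> strictly_upper n" "root_entry \<beta> X = 0"
  shows "lower_conj n \<beta> t X \<in> strictly_upper n"
proof -
  have "i < j" if ij: "i < n" "j < n" and nz: "lower_conj n \<beta> t X $$ (i, j) \<noteq> 0" for i j
  proof (rule ccontr)
    assume "\<not> i < j"
    then show False
      using nz ij \<beta> strictly_upper_zero[OF assms(1), of i j] strictly_upper_zero[OF assms(1), of \<beta> j]
        strictly_upper_zero[OF assms(1), of i "\<beta> + 1"] assms(2)
      by (cases "j = \<beta> + 1"; cases "i = \<beta>"; auto simp: lower_conj_def root_entry_def split: if_splits)
  qed
  then show ?thesis by (simp add: strictly_upper_def)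
qed

text \<open>Where the \<open>\<alpha> + \<beta>\<close> coordinate does not vanish, \<open>X \<mapsto> lower_conj n \<beta> (clearing \<alpha> \<beta> X) X\<close> is a
  rational retraction onto the locus where the \<open>\<alpha>\<close> coordinate vanishes. It suffices to know that it
  maps \<open>B(\<nn> \<inter> \<^sup>y\<nn>)\<close> into the closure for \<open>z\<close>.\<close>

lemma borel_closure_transfer:
  assumes h: "h \<in> polynomial_functions n" "X0 \<in> n_cap_conj n y" "h X0 \<noteq> 0"
    and \<beta>0: "\<And>X. X \<in> n_cap_conj n y \<Longrightarrow> root_entry \<beta> X = 0"
    and slice: "\<And>X. X \<in> n_cap_conj n y \<Longrightarrow> h X \<noteq> 0 \<Longrightarrow>
      \<exists>X' q q'. similar_mat_wit X X' q q' \<and> almost_upper \<beta> q \<and> X' \<in> strictly_upper n \<and>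
        X' \<in> borel_closure n z \<and> root_entry \<alpha> X' = 0 \<and> sum_entry \<alpha> \<beta> X' \<noteq> 0"
    and Y: "Y \<in> borel_closure n y" "root_entry \<alpha> Y = 0" "sum_entry \<alpha> \<beta> Y \<noteq> 0"
  shows "Y \<in> borel_closure n z"
proof -
  let ?N = "{X \<in> n_cap_conj n y. h X \<noteq> 0}" and ?\<gamma> = "sum_entry \<alpha> \<beta>" and ?zc = "zariski_closure n"
  define \<rho> where "\<rho> = (\<lambda>X. lower_conj n \<beta> (clearing \<alpha> \<beta> X) X)"
  define T where "T = saturation (Borel n) (n_cap_conj n z)"
  \<comment> \<open>\<open>clearing\<close> divides by the \<alpha> + \<beta> coordinate, so
    pulled-back equations live in the localization at this coordinate.\<close>
  interpret loc: function_algebra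
    "{g. \<exists>N. \<exists>f\<in>polynomial_functions n. \<forall>X. ?\<gamma> X \<noteq> 0 \<longrightarrow> f X = ?\<gamma> X ^ N * g X}"
    by (rule function_algebra_localization[OF sum_entry_polynomial])
  have poly_loc: "f \<in> {g. \<exists>N. \<exists>f\<in>polynomial_functions n. \<forall>X. ?\<gamma> X \<noteq> 0 \<longrightarrow> f X = ?\<gamma> X ^ N * g X}"
    if "f \<in> polynomial_functions n" for f
    using that by (auto intro!: exI[of _ 0] bexI[of _ f])
  have "(\<lambda>X. inverse (?\<gamma> X)) \<in> {g. \<exists>N. \<exists>f\<in>polynomial_functions n. \<forall>X. ?\<gamma> X \<noteq> 0 \<longrightarrow> f X = ?\<gamma> X ^ N * g X}"
    using polynomial_functions.const_mem[of 1 n]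
    by (auto intro!: exI[of _ 1] bexI[of _ "\<lambda>_. 1"])
  then have clr: "clearing \<alpha> \<beta> \<in> {g. \<exists>N. \<exists>f\<in>polynomial_functions n. \<forall>X. ?\<gamma> X \<noteq> 0 \<longrightarrow> f X = ?\<gamma> X ^ N * g X}"
    unfolding clearing_def[abs_def]
    by (intro loc.mult_mem loc.const_mem poly_loc[OF root_entry_polynomial(1)])
  have trunc_loc: "trunc n \<in> loc.matrices n n"
    using polynomial_functions.matrices_entry[OF trunc_mem]
    by (intro loc.matricesI poly_loc) (auto simp: trunc_def)
  have \<rho>_loc: "(\<lambda>X. lower_conj n \<beta> (clearing \<alpha> \<beta> X) (trunc n X)) \<in> loc.matrices n n"
    by (rule loc.matrices_lower_conj[OF clr trunc_loc \<beta>])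
  \<comment> \<open>Both \<open>\<rho> A\<close> and \<open>X'\<close> have zero \<alpha> coordinate
    and nonzero \<alpha> + \<beta> coordinate, and they are conjugate under the parabolic of
    \<beta>. By \<open>conj_upper_triangular\<close> the conjugating matrix is upper triangular, so
    it preserves the closure for \<open>z\<close>.\<close>
  have base: "\<rho> A \<in> borel_closure n z" if A: "A \<in> saturation (Borel n) ?N" and \<gamma>A: "?\<gamma> A \<noteq> 0" for A
  proof -
    obtain X b b' where X: "X \<in> n_cap_conj n y" "h X \<noteq> 0" and b: "upper_triangular b"
      and wit: "similar_mat_wit A X b b'"
      using A by (auto simp: saturation_def Borel_def)
    obtain X' q q' where q: "similar_mat_wit X X' q q'" "almost_upper \<beta> q" and X': "X' \<in> strictly_upper n"
      "X' \<in> borel_closure n z" "root_entry \<alpha> X' = 0" "?\<gamma> X' \<noteq> 0"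
      using slice[OF X] by blast
    have Xu: "X \<in> strictly_upper n" using X(1) n_cap_conj_strictly_upper by blast
    have Au: "A \<in> strictly_upper n" by (rule strictly_upper_conj(1)[OF wit b Xu])
    note w = similar_mat_witD2[OF strictly_upper_carrier[OF Au] wit]
    have "root_entry \<beta> A * b $$ (\<beta> + 1, \<beta> + 1) = 0"
      using strictly_upper_conj(2)[OF wit b Xu \<beta>] \<beta>0[OF X(1)] by (simp add: root_entry_def)
    then have "root_entry \<beta> A = 0"
      using upper_triangular_invertible_diag[OF w(6) b w(7,1) \<beta>] by simp
    then have \<rho>u: "\<rho> A \<in> strictly_upper n"
      unfolding \<rho>_def by (rule strictly_upper_lower_conj[OF Au])
    note wq = similar_mat_witD2[OF w(5) q(1)]
    let ?L = "lower_mat n \<beta> (clearing \<alpha> \<beta> A)"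
    have "similar_mat_wit (\<rho> A) X (?L * b) (b' * lower_mat n \<beta> (- clearing \<alpha> \<beta> A))"
      unfolding \<rho>_def
      by (rule similar_mat_wit_trans[OF similar_lower_conj[OF strictly_upper_carrier[OF Au] \<beta>] wit])
    note wit' = similar_mat_wit_trans[OF this q(1)]
    have Lb: "?L * b \<in> carrier_mat n n" by (rule mult_carrier_mat[OF elementary_carrier(1) w(6)])
    have "almost_upper \<beta> (?L * b * q)"
      by (intro almost_upper_mult[where n = n] almost_upper_lower_mat almost_upper_upper b q(2) Lb w(6) wq(6))
        simp
    then have "upper_triangular (?L * b * q)"
      by (rule conj_upper_triangular[OF wit' _ \<rho>u])
        (use X' \<gamma>A lower_conj_clearing in \<open>auto simp: \<rho>_def\<close>)
    then show ?thesis by (rule borel_closure_upper[OF X'(2) wit'])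
  qed
  have N_sl: "?N \<subseteq> sl n" using n_cap_conj_sl by blast
  have "n_cap_conj n y \<subseteq> ?zc ?N"
    by (rule affine_subset_zariski_closure[OF n_cap_conj_sl line_n_cap_conj h(1,2,3)])
      (use zariski_closure_incl[OF N_sl] in blast)+
  moreover have "saturation (Borel n) (?zc ?N) \<subseteq> ?zc (saturation (Borel n) ?N)"
    by (rule saturation_zariski_closure[OF N_sl zariski_closure_incl[OF saturation_sl[OF N_sl]]])
  ultimately have "saturation (Borel n) (n_cap_conj n y) \<subseteq> ?zc (saturation (Borel n) ?N)"
    using saturation_mono[OF order_refl] by blast
  then have Y_zc: "Y \<in> ?zc (saturation (Borel n) ?N)"
    using Y(1) zariski_closure_minimal unfolding borel_closure_def by blast
  have Ysl: "Y \<in> sl n" using Y(1) borel_closure_sl by blast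
  \<comment> \<open>The parameter \<open>clearing\<close> is 0 at \<open>Y\<close>, whose \<alpha>
    coordinate vanishes.\<close>
  have \<rho>Y: "\<rho> Y = Y"
    using Y(2) lower_conj_0[OF sl_carrier[OF Ysl]] by (simp add: \<rho>_def clearing_def)
  show ?thesis
    unfolding borel_closure_def T_def[symmetric]
  proof (rule zariski_closureI[OF Ysl])
    fix f assume f: "f \<in> polynomial_functions n" "\<And>X. X \<in> T \<Longrightarrow> f X = 0"
    from loc.polynomial_function_comp[OF f(1) \<rho>_loc] obtain N F
      where F: "F \<in> polynomial_functions n"
        and F_eq: "\<And>X. ?\<gamma> X \<noteq> 0 \<Longrightarrow> F X = ?\<gamma> X ^ N * f (lower_conj n \<beta> (clearing \<alpha> \<beta> X) (trunc n X))"
      by auto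
    have F_sl: "F X = ?\<gamma> X ^ N * f (\<rho> X)" if "X \<in> sl n" "?\<gamma> X \<noteq> 0" for X
      using F_eq[OF that(2)] sl_carrier[OF that(1)] by (simp add: \<rho>_def)
    \<comment> \<open>The extra factor covers the points where the \<alpha> + \<beta> coordinate
      vanishes, since \<open>F\<close> is controlled only elsewhere.\<close>
    have "?\<gamma> Y * F Y = 0"
    proof (rule zariski_closureD[OF Y_zc polynomial_functions.mult_mem[OF sum_entry_polynomial F]])
      fix A assume A: "A \<in> saturation (Borel n) ?N"
      then have "A \<in> sl n" using saturation_sl[OF N_sl] by blast
      then show "?\<gamma> A * F A = 0"
        using F_sl base[OF A] zariski_closureD[OF _ f(1) f(2)]
        unfolding borel_closure_def T_def[symmetric] by (cases "?\<gamma> A = 0") auto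
    qed
    then show "f Y = 0" using F_sl[OF Ysl Y(3)] Y(3) \<rho>Y by simp
  qed
qed

end

section \<open>Combinatorics of the operators \<open>T_op\<close>\<close>

lemma tau_iff: "k + 1 < n \<Longrightarrow> k \<in> tau n w \<longleftrightarrow> Hilbert_Choice.inv w (k + 1) < Hilbert_Choice.inv w k"
  by (simp add: tau_def simple_roots_def)

lemma D_set_bij: "w \<in> D_set n \<alpha> \<beta> \<Longrightarrow> bij w"
  by (auto simp: D_set_def permutes_bij)

lemma simple_reflection_comp_permutes:
  "k + 1 < n \<Longrightarrow> w permutes {..<n} \<Longrightarrow> simple_reflection k \<circ> w permutes {..<n}"
  unfolding simple_reflection_def by (intro permutes_compose permutes_swap_id) auto

lemma simple_reflection_comp_involution [simp]:
  "simple_reflection k \<circ> (simple_reflection k \<circ> w) = w"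
  by (simp add: fun_eq_iff)

context adjacent_pair
begin

lemma swapped: "adjacent_pair n \<beta> \<alpha>"
  using \<alpha> \<beta> adj by unfold_locales (simp_all add: adjacent_roots_def insert_commute)

text \<open>Among the values of \<open>inv w\<close> at the three consecutive indices from
  \<open>min \<alpha> \<beta>\<close> on, the comparison of the outer two decides which reflection
  applies.\<close>

lemma D_set_cases:
  assumes w: "w \<in> D_set n \<alpha> \<beta>"
  obtains (refl_\<alpha>) "T_op n \<alpha> \<beta> w = simple_reflection \<alpha> \<circ> w"
      "Hilbert_Choice.inv w (min \<alpha> \<beta>) < Hilbert_Choice.inv w (min \<alpha> \<beta> + 2)"
      "T_op n \<alpha> \<beta> w \<in> D_set n \<beta> \<alpha>" "T_op n \<beta> \<alpha> (T_op n \<alpha> \<beta> w) = w"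
    | (refl_\<beta>) "T_op n \<alpha> \<beta> w = simple_reflection \<beta> \<circ> w"
      "Hilbert_Choice.inv w (min \<alpha> \<beta> + 2) < Hilbert_Choice.inv w (min \<alpha> \<beta>)"
      "Hilbert_Choice.inv (T_op n \<alpha> \<beta> w) (min \<alpha> \<beta>) < Hilbert_Choice.inv (T_op n \<alpha> \<beta> w) (min \<alpha> \<beta> + 2)"
      "T_op n \<alpha> \<beta> w \<in> D_set n \<beta> \<alpha>" "T_op n \<beta> \<alpha> (T_op n \<alpha> \<beta> w) = w"
proof -
  let ?v = "Hilbert_Choice.inv w"
  have perm: "w permutes {..<n}" and tau: "\<alpha> \<notin> tau n w" "\<beta> \<in> tau n w"
    using w by (auto simp: D_set_def)
  note bij = D_set_bij[OF w]
  have neq: "?v i \<noteq> ?v j" if "i \<noteq> j" for i j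
    using bij_imp_bij_inv[OF bij] that by (auto simp: bij_def inj_eq)
  note permk = simple_reflection_comp_permutes[OF _ perm]
  have inv1: "Hilbert_Choice.inv (simple_reflection k \<circ> w) i = ?v (simple_reflection k i)" for k i
    by (rule inv_simple_reflection_comp[OF bij])
  have inv2: "Hilbert_Choice.inv (simple_reflection l \<circ> (simple_reflection k \<circ> w)) i =
      ?v (simple_reflection k (simple_reflection l i))" if "k + 1 < n" for k l i
    using inv_simple_reflection_comp[OF permutes_bij[OF permk[OF that]]] inv1 by simp
  have \<alpha>less: "?v \<alpha> < ?v (\<alpha> + 1)" and \<beta>less: "?v (\<beta> + 1) < ?v \<beta>"
    using tau tau_iff[OF \<alpha>] tau_iff[OF \<beta>] neq[of \<alpha> "\<alpha> + 1"] by auto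
  show thesis
  proof (cases "\<beta> \<in> tau n (simple_reflection \<alpha> \<circ> w)")
    case False
    then have T: "T_op n \<alpha> \<beta> w = simple_reflection \<alpha> \<circ> w" by (simp add: T_op_def)
    have nless: "\<not> ?v (simple_reflection \<alpha> (\<beta> + 1)) < ?v (simple_reflection \<alpha> \<beta>)"
      using False by (simp add: tau_iff[OF \<beta>] inv1)
    have less: "?v (min \<alpha> \<beta>) < ?v (min \<alpha> \<beta> + 2)"
      using adj nless neq[of "min \<alpha> \<beta>" "min \<alpha> \<beta> + 2"]
      by (cases rule: adjacent_cases) (simp_all add: simple_reflection_apply)
    have "\<alpha> \<in> tau n (simple_reflection \<alpha> \<circ> w)"
      using \<alpha>less by (simp add: tau_iff[OF \<alpha>] inv1 simple_reflection_apply)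
    then have "T_op n \<alpha> \<beta> w \<in> D_set n \<beta> \<alpha>"
      using False permk[OF \<alpha>] by (simp add: D_set_def T)
    moreover have "\<alpha> \<in> tau n (simple_reflection \<beta> \<circ> (simple_reflection \<alpha> \<circ> w))"
      using adj less \<alpha>less \<beta>less unfolding tau_iff[OF \<alpha>] inv2[OF \<alpha>]
      by (cases rule: adjacent_cases) (simp_all add: simple_reflection_apply)
    then have "T_op n \<beta> \<alpha> (T_op n \<alpha> \<beta> w) = w"
      unfolding T by (simp add: T_op_def)
    ultimately show thesis using refl_\<alpha> T less by blast
  next
    case True
    then have T: "T_op n \<alpha> \<beta> w = simple_reflection \<beta> \<circ> w" by (simp add: T_op_def)
    have less': "?v (simple_reflection \<alpha> (\<beta> + 1)) < ?v (simple_reflection \<alpha> \<beta>)"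
      using True by (simp add: tau_iff[OF \<beta>] inv1)
    have less: "?v (min \<alpha> \<beta> + 2) < ?v (min \<alpha> \<beta>)"
      using adj less' by (cases rule: adjacent_cases) (simp_all add: simple_reflection_apply)
    have "\<beta> \<notin> tau n (simple_reflection \<beta> \<circ> w)"
      using \<beta>less by (simp add: tau_iff[OF \<beta>] inv1 simple_reflection_apply)
    moreover have "\<alpha> \<in> tau n (simple_reflection \<beta> \<circ> w)"
      using adj less unfolding tau_iff[OF \<alpha>] inv1
      by (cases rule: adjacent_cases) (simp_all add: simple_reflection_apply)
    ultimately have "T_op n \<alpha> \<beta> w \<in> D_set n \<beta> \<alpha>"
      using permk[OF \<beta>] by (simp add: D_set_def T)
    moreover have "T_op n \<beta> \<alpha> (T_op n \<alpha> \<beta> w) = w"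
      unfolding T using tau(1) by (simp add: T_op_def)
    moreover have "Hilbert_Choice.inv (T_op n \<alpha> \<beta> w) (min \<alpha> \<beta>) < Hilbert_Choice.inv (T_op n \<alpha> \<beta> w) (min \<alpha> \<beta> + 2)"
      unfolding T inv1 using adj \<alpha>less
      by (cases rule: adjacent_cases) (simp_all add: simple_reflection_apply)
    ultimately show thesis using refl_\<beta> T less by blast
  qed
qed

section \<open>Comparison of the closures in the two cases\<close>

lemma unit_n_cap_conj:
  assumes "i < j" "j < n" "Hilbert_Choice.inv w i < Hilbert_Choice.inv w j"
  shows "mat n n (\<lambda>p. if p = (i, j) then 1 else 0) \<in> n_cap_conj n w"
  using assms unfolding n_cap_conj_iff by auto

text \<open>A matrix unit provides the point with nonzero coordinate that the density argument
  requires.\<close>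

lemma root_entry_unit:
  assumes "k + 1 < n" "k \<notin> tau n w" "bij w"
  obtains X where "X \<in> n_cap_conj n w" "root_entry k X \<noteq> 0"
proof -
  have "Hilbert_Choice.inv w k \<noteq> Hilbert_Choice.inv w (k + 1)"
    using bij_imp_bij_inv[OF assms(3)] by (auto simp: bij_def inj_eq)
  then have "Hilbert_Choice.inv w k < Hilbert_Choice.inv w (k + 1)"
    using assms(1,2) by (simp add: tau_iff)
  from unit_n_cap_conj[OF _ assms(1) this] that show thesis
    using assms(1) by (simp add: root_entry_def)
qed

lemma sum_entry_unit:
  assumes "Hilbert_Choice.inv w (min \<alpha> \<beta>) < Hilbert_Choice.inv w (min \<alpha> \<beta> + 2)"
  obtains X where "X \<in> n_cap_conj n w" "sum_entry \<alpha> \<beta> X \<noteq> 0"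
  using unit_n_cap_conj[OF _ min_less assms] that min_less by (simp add: sum_entry_def)

lemma root_entry_tau:
  assumes "X \<in> n_cap_conj n w" "k \<in> tau n w"
  shows "root_entry k X = 0"
proof (rule ccontr)
  assume "root_entry k X \<noteq> 0"
  moreover have "k + 1 < n" using assms(2) by (simp add: tau_def simple_roots_def)
  ultimately have "Hilbert_Choice.inv w k < Hilbert_Choice.inv w (k + 1)"
    using assms(1) unfolding n_cap_conj_iff root_entry_def by auto
  then show False using assms(2) by (simp add: tau_def)
qed

lemma borel_closure_slice_subset:
  assumes y: "y \<in> D_set n \<alpha> \<beta>"
    and Y: "Y \<in> borel_closure n y" "root_entry \<alpha> Y = 0" "sum_entry \<alpha> \<beta> Y \<noteq> 0"
  shows "Y \<in> borel_closure n (T_op n \<alpha> \<beta> y)"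
proof -
  have tau: "\<alpha> \<notin> tau n y" "\<beta> \<in> tau n y" using y by (auto simp: D_set_def)
  note bij = D_set_bij[OF y]
  let ?z = "T_op n \<alpha> \<beta> y"
  have \<beta>0: "root_entry \<beta> X = 0" if "X \<in> n_cap_conj n y" for X
    using root_entry_tau[OF that tau(2)] .
  have C: "X \<in> carrier_mat n n" if "X \<in> n_cap_conj n v" for X v
    using that n_cap_conj_iff by blast
  have U: "X \<in> strictly_upper n" if "X \<in> n_cap_conj n v" for X v
    using that n_cap_conj_strictly_upper by blast
  show ?thesis
    using y
  proof (cases rule: D_set_cases)
    case refl_\<alpha>
    obtain X0 where X0: "X0 \<in> n_cap_conj n y" "sum_entry \<alpha> \<beta> X0 \<noteq> 0"
      using sum_entry_unit[OF refl_\<alpha>(2)] by blast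
    have \<alpha>z: "\<alpha> \<in> tau n ?z" using refl_\<alpha>(3) by (simp add: D_set_def)
    show ?thesis
    proof (rule borel_closure_transfer[OF sum_entry_polynomial X0 \<beta>0 _ Y])
      fix X assume X: "X \<in> n_cap_conj n y" "sum_entry \<alpha> \<beta> X \<noteq> 0"
      \<comment> \<open>Clearing the \<alpha> coordinate stays in \<open>n_cap_conj n y\<close>. The
        reflection at \<alpha> then leads into \<open>n_cap_conj n ?z\<close>, and the closure for
        \<open>?z\<close> is stable under this reflection.\<close>
      define t where "t = clearing \<alpha> \<beta> X"
      let ?X' = "lower_conj n \<beta> t X"
      have X': "?X' \<in> n_cap_conj n y" by (rule n_cap_conj_lower_conj[OF X(1) tau(2)])
      have zero: "root_entry \<alpha> ?X' = 0" and nz: "sum_entry \<alpha> \<beta> ?X' \<noteq> 0"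
        using lower_conj_clearing X(2) by (simp_all add: t_def)
      have "swap_conj n \<alpha> ?X' \<in> n_cap_conj n ?z"
        unfolding refl_\<alpha>(1) using n_cap_conj_swap_conj[OF X' _ \<alpha> bij] zero by (simp add: root_entry_def)
      then have "swap_conj n \<alpha> (swap_conj n \<alpha> ?X') \<in> borel_closure n ?z"
        using borel_closure_swap_conj[OF _ \<alpha>z] n_cap_conj_borel_closure by blast
      then have "?X' \<in> borel_closure n ?z"
        using swap_conj_involution[OF C[OF X'] \<alpha>] by simp
      then show "\<exists>X' q q'. similar_mat_wit X X' q q' \<and> almost_upper \<beta> q \<and> X' \<in> strictly_upper n \<and>
          X' \<in> borel_closure n ?z \<and> root_entry \<alpha> X' = 0 \<and> sum_entry \<alpha> \<beta> X' \<noteq> 0"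
        using similar_mat_wit_sym[OF similar_lower_conj[OF C[OF X(1)] \<beta>, of t]]
          almost_upper_lower_mat U[OF X'] zero nz by blast
    qed
  next
    case refl_\<beta>
    obtain X0 where X0: "X0 \<in> n_cap_conj n y" "root_entry \<alpha> X0 \<noteq> 0"
      using root_entry_unit[OF \<alpha> tau(1) bij] by blast
    show ?thesis
    proof (rule borel_closure_transfer[OF root_entry_polynomial(1) X0 \<beta>0 _ Y])
      fix X assume X: "X \<in> n_cap_conj n y" "root_entry \<alpha> X \<noteq> 0"
      \<comment> \<open>Here the \<alpha> + \<beta> coordinate of \<open>X\<close> is zero, and the
        reflection at \<beta> exchanges it with the nonzero \<alpha> coordinate.\<close>
      let ?X' = "swap_conj n \<beta> X"
      have X': "?X' \<in> n_cap_conj n ?z"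
        unfolding refl_\<beta>(1) using n_cap_conj_swap_conj[OF X(1) _ \<beta> bij] \<beta>0[OF X(1)]
        by (simp add: root_entry_def)
      have "sum_entry \<alpha> \<beta> X = 0"
      proof (rule ccontr)
        assume "sum_entry \<alpha> \<beta> X \<noteq> 0"
        then have "Hilbert_Choice.inv y (min \<alpha> \<beta>) < Hilbert_Choice.inv y (min \<alpha> \<beta> + 2)"
          using X(1) min_less unfolding n_cap_conj_iff sum_entry_def by auto
        then show False using refl_\<beta>(2) by simp
      qed
      then show "\<exists>X' q q'. similar_mat_wit X X' q q' \<and> almost_upper \<beta> q \<and> X' \<in> strictly_upper n \<and>
          X' \<in> borel_closure n ?z \<and> root_entry \<alpha> X' = 0 \<and> sum_entry \<alpha> \<beta> X' \<noteq> 0"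
        using similar_mat_wit_sym[OF similar_swap_conj[OF C[OF X(1)] \<beta>]] almost_upper_swap_mat
          U[OF X'] subsetD[OF n_cap_conj_borel_closure X'] root_entry_swap_conj X(2) by metis
    qed
  qed
qed

text \<open>By density it is enough to treat elements with a nonzero coordinate at \<beta> or at
  \<alpha> + \<beta>, depending on the case. Conjugation brings them into the slice handled by
  \<open>borel_closure_slice_subset\<close>.\<close>

lemma n_cap_conj_T_op_subset:
  assumes w: "w \<in> D_set n \<alpha> \<beta>" and y: "y \<in> D_set n \<alpha> \<beta>"
    and wy: "n_cap_conj n w \<subseteq> borel_closure n y"
  shows "n_cap_conj n (T_op n \<alpha> \<beta> w) \<subseteq> borel_closure n (T_op n \<alpha> \<beta> y)"
proof -
  interpret swp: adjacent_pair n \<beta> \<alpha> by (rule swapped)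
  let ?v = "T_op n \<alpha> \<beta> w" and ?z = "T_op n \<alpha> \<beta> y"
  have zD: "?z \<in> D_set n \<beta> \<alpha>" and vD: "?v \<in> D_set n \<beta> \<alpha>"
    using w y by (metis D_set_cases)+
  have tau: "\<alpha> \<in> tau n ?z" "\<alpha> \<in> tau n ?v" "\<beta> \<notin> tau n ?v" "\<beta> \<in> tau n y"
    using zD vD y by (auto simp: D_set_def)
  note bij = D_set_bij[OF vD]
  have C: "X \<in> carrier_mat n n" if "X \<in> n_cap_conj n ?v" for X
    using that n_cap_conj_iff by blast
  have \<alpha>0: "root_entry \<alpha> X = 0" if "X \<in> n_cap_conj n ?v" for X
    using root_entry_tau[OF that tau(2)] .
  show ?thesis
    using w
  proof (cases rule: D_set_cases)
    case refl_\<alpha>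
    obtain X0 where X0: "X0 \<in> n_cap_conj n ?v" "root_entry \<beta> X0 \<noteq> 0"
      using root_entry_unit[OF \<beta> tau(3) bij] by blast
    show ?thesis
      unfolding borel_closure_def
    proof (rule affine_subset_zariski_closure[OF n_cap_conj_sl line_n_cap_conj root_entry_polynomial(2) X0])
      fix X assume X: "X \<in> n_cap_conj n ?v" "root_entry \<beta> X \<noteq> 0"
      \<comment> \<open>The \<alpha> coordinate of \<open>?X'\<close> comes from below the diagonal
        of \<open>X\<close>, and its \<alpha> + \<beta> coordinate is the \<beta> coordinate of
        \<open>X\<close>.\<close>
      let ?X' = "swap_conj n \<alpha> X"
      have "?X' \<in> n_cap_conj n (simple_reflection \<alpha> \<circ> ?v)"
        using n_cap_conj_swap_conj[OF X(1) _ \<alpha> bij] \<alpha>0[OF X(1)] by (simp add: root_entry_def)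
      then have "?X' \<in> borel_closure n y" using wy by (auto simp: refl_\<alpha>(1))
      moreover have "root_entry \<alpha> ?X' = 0"
        using strictly_upper_zero[OF subsetD[OF n_cap_conj_strictly_upper X(1)], of "\<alpha> + 1" \<alpha>] \<alpha>
        by (simp add: root_entry_def swap_conj_def simple_reflection_apply)
      moreover have "sum_entry \<alpha> \<beta> ?X' \<noteq> 0"
        using swp.root_entry_swap_conj(2)[of X] X(2) by (simp add: sum_entry_commute)
      ultimately have "?X' \<in> borel_closure n ?z" by (rule borel_closure_slice_subset[OF y])
      then have "swap_conj n \<alpha> ?X' \<in> borel_closure n ?z"
        by (rule borel_closure_swap_conj[OF _ tau(1)])
      then show "X \<in> zariski_closure n (saturation (Borel n) (n_cap_conj n ?z))"
        using swap_conj_involution[OF C[OF X(1)] \<alpha>] by (simp add: borel_closure_def)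
    qed
  next
    case refl_\<beta>
    obtain X0 where X0: "X0 \<in> n_cap_conj n ?v" "sum_entry \<alpha> \<beta> X0 \<noteq> 0"
      using sum_entry_unit[OF refl_\<beta>(3)] by blast
    show ?thesis
      unfolding borel_closure_def
    proof (rule affine_subset_zariski_closure[OF n_cap_conj_sl line_n_cap_conj sum_entry_polynomial X0])
      fix X assume X: "X \<in> n_cap_conj n ?v" "sum_entry \<alpha> \<beta> X \<noteq> 0"
      \<comment> \<open>Clearing the \<beta> coordinate permits the reflection at \<beta> into
        \<open>n_cap_conj n w\<close>. The closure for \<open>y\<close> is stable under this
        reflection, so it contains \<open>?X'\<close> itself; the clearing is undone inside the
        closure for \<open>?z\<close>.\<close>
      define t where "t = clearing \<beta> \<alpha> X"
      let ?X' = "lower_conj n \<alpha> t X"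
      have X': "?X' \<in> n_cap_conj n ?v" by (rule n_cap_conj_lower_conj[OF X(1) tau(2)])
      have zero: "root_entry \<beta> ?X' = 0" and nz: "sum_entry \<alpha> \<beta> ?X' \<noteq> 0"
        using swp.lower_conj_clearing X(2) by (simp_all add: t_def sum_entry_commute)
      have "swap_conj n \<beta> ?X' \<in> n_cap_conj n (simple_reflection \<beta> \<circ> ?v)"
        using n_cap_conj_swap_conj[OF X' _ \<beta> bij] zero by (simp add: root_entry_def)
      then have "swap_conj n \<beta> ?X' \<in> borel_closure n y" using wy by (auto simp: refl_\<beta>(1))
      then have "swap_conj n \<beta> (swap_conj n \<beta> ?X') \<in> borel_closure n y"
        by (rule borel_closure_swap_conj[OF _ tau(4)])
      then have "?X' \<in> borel_closure n y" using swap_conj_involution[OF C[OF X'] \<beta>] by simp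
      then have "?X' \<in> borel_closure n ?z"
        using \<alpha>0[OF X'] nz by (rule borel_closure_slice_subset[OF y])
      then have "lower_conj n \<alpha> (- t) ?X' \<in> borel_closure n ?z"
        by (rule borel_closure_lower_conj[OF _ tau(1)])
      then show "X \<in> zariski_closure n (saturation (Borel n) (n_cap_conj n ?z))"
        using lower_conj_inverse[OF C[OF X(1)] \<alpha>] by (simp add: borel_closure_def)
    qed
  qed
qed

end

theorem theorem5p5:
  fixes n \<alpha> \<beta> :: nat and w y :: "nat \<Rightarrow> nat"
  assumes "\<alpha> \<in> simple_roots n" and "\<beta> \<in> simple_roots n"
    and "adjacent_roots \<alpha> \<beta>"
    and "w \<in> D_set n \<alpha> \<beta>" and "y \<in> D_set n \<alpha> \<beta>"
  shows "orbital_variety n w \<subseteq> zariski_closure n (orbital_variety n y) \<longleftrightarrow>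
    orbital_variety n (T_op n \<alpha> \<beta> w)
      \<subseteq> zariski_closure n (orbital_variety n (T_op n \<alpha> \<beta> y))"
proof -
  interpret adjacent_pair n \<alpha> \<beta>
    using assms(1-3) by unfold_locales (simp_all add: simple_roots_def)
  interpret swp: adjacent_pair n \<beta> \<alpha> by (rule swapped)
  have T: "T_op n \<alpha> \<beta> x \<in> D_set n \<beta> \<alpha>" "T_op n \<beta> \<alpha> (T_op n \<alpha> \<beta> x) = x"
    if "x \<in> D_set n \<alpha> \<beta>" for x
    using that by (metis D_set_cases)+
  show ?thesis
    unfolding orbital_variety_subset_iff
    \<comment> \<open>The converse is the same inclusion with the two roots interchanged, applied to
      the images under \<open>T_op n \<alpha> \<beta>\<close>.\<close>
    using n_cap_conj_T_op_subset[OF assms(4,5)]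
      swp.n_cap_conj_T_op_subset[OF T(1)[OF assms(4)] T(1)[OF assms(5)]] T(2)[OF assms(4)] T(2)[OF assms(5)]
    by auto
qed

end
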